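(* Let $\mathcal{C}=\{C_1,\dots,C_k\}\subset\mathbb{P}^2_{\mathbb{C}}$ be a $d$-arrangement of $k\geq 3$ curves, and let $G$ be its Levi graph. Let $S=\mathbb{K}[a_v,b_v : v\in V(G)]$ over a field $\mathbb{K}$ and let $J_G$ be the binomial edge ideal of $G$. Then $S/J_G$ is not Cohen–Macaulay.
   Context: A $d$-arrangement is an arrangement $\mathcal{C}=\{C_1,\dots,C_k\}$ of $k\geq 3$ smooth plane curves all of the same degree $d\geq 1$ such that the singular locus $\mathrm{Sing}(\mathcal{C})$ of the union consists only of ordinary intersection points (locally like intersections of lines). The Levi graph of $\mathcal{C}$ is the bipartite graph with one vertex for each point $p\in\mathrm{Sing}(\mathcal{C})$, one vertex for each curve $C_j$, and an edge between the vertex of $p$ and the vertex of $C_j$ iff $p\in C_j$. For a graph with vertices labelled $1,\dots,n$, the binomial edge ideal $J_G\subseteq \mathbb{K}[a_1,\dots,a_n,b_1,\dots,b_n]$ is generated by $a_ib_j-a_jb_i$ for all edges $\{i,j\}$ with $i<j$. *)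

theory Defs
  imports Complex_Main "HOL-Library.Poly_Mapping" "HOL-Library.Extended_Nat" "HOL-Library.Product_Plus"
begin

type_synonym cpt = "complex \<times> complex \<times> complex"

text \<open>A homogeneous polynomial of degree d in x,y,z is given by its coefficient
function on exponent triples (a,b,c); it must vanish outside a+b+c = d.\<close>
type_synonym hpoly = "nat \<times> nat \<times> nat \<Rightarrow> complex"

definition hmonos :: "nat \<Rightarrow> (nat \<times> nat \<times> nat) set" where
  "hmonos d = {(a,b,c). a + b + c = d}"

definition is_hpoly :: "nat \<Rightarrow> hpoly \<Rightarrow> bool" where
  "is_hpoly d F \<longleftrightarrow> (\<forall>m. m \<notin> hmonos d \<longrightarrow> F m = 0) \<and> (\<exists>m. F m \<noteq> 0)"

definition heval :: "nat \<Rightarrow> hpoly \<Rightarrow> cpt \<Rightarrow> complex" where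
  "heval d F p = (case p of (x,y,z) \<Rightarrow>
     (\<Sum>(a,b,c)\<in>hmonos d. F (a,b,c) * x^a * y^b * z^c))"

definition hgrad :: "nat \<Rightarrow> hpoly \<Rightarrow> cpt \<Rightarrow> cpt" where
  "hgrad d F p = (case p of (x,y,z) \<Rightarrow>
     ((\<Sum>(a,b,c)\<in>hmonos d. F (a,b,c) * of_nat a * x^(a-1) * y^b * z^c),
      (\<Sum>(a,b,c)\<in>hmonos d. F (a,b,c) * of_nat b * x^a * y^(b-1) * z^c),
      (\<Sum>(a,b,c)\<in>hmonos d. F (a,b,c) * of_nat c * x^a * y^b * z^(c-1))))"

definition scal :: "complex \<Rightarrow> cpt \<Rightarrow> cpt" where
  "scal t p = (case p of (x,y,z) \<Rightarrow> (t*x, t*y, t*z))"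

definition cadd :: "cpt \<Rightarrow> cpt \<Rightarrow> cpt" where
  "cadd p q = (case p of (x,y,z) \<Rightarrow> case q of (u,v,w) \<Rightarrow> (x+u, y+v, z+w))"

text \<open>The point of P^2 represented by a nonzero vector: its punctured line.\<close>
definition proj :: "cpt \<Rightarrow> cpt set" where
  "proj p = {scal t p | t. t \<noteq> 0}"

definition smooth_curve :: "nat \<Rightarrow> hpoly \<Rightarrow> bool" where
  "smooth_curve d F \<longleftrightarrow> is_hpoly d F \<and>
     (\<forall>p. p \<noteq> (0,0,0) \<and> heval d F p = 0 \<longrightarrow> hgrad d F p \<noteq> (0,0,0))"

definition zero_set :: "nat \<Rightarrow> hpoly \<Rightarrow> cpt set" where
  "zero_set d F = {p. p \<noteq> (0,0,0) \<and> heval d F p = 0}"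

text \<open>Singular points of the union C_0 \<union> ... \<union> C_(k-1), i.e. of the curve defined by
the product F_0 \<cdot> ... \<cdot> F_(k-1) (value and gradient via the Leibniz rule).\<close>
definition union_singular :: "nat \<Rightarrow> nat \<Rightarrow> (nat \<Rightarrow> hpoly) \<Rightarrow> cpt \<Rightarrow> bool" where
  "union_singular d k F p \<longleftrightarrow> p \<noteq> (0,0,0) \<and>
     (\<Prod>j<k. heval d (F j) p) = 0 \<and>
     (\<Sum>j<k. scal (\<Prod>l\<in>{..<k}-{j}. heval d (F l) p) (hgrad d (F j) p)) = (0,0,0)"

definition Sing :: "nat \<Rightarrow> nat \<Rightarrow> (nat \<Rightarrow> hpoly) \<Rightarrow> cpt set set" where
  "Sing d k F = {proj p | p. union_singular d k F p}"

text \<open>Ordinary singularities: at every singular point of the union, any two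
curves through it meet transversally (pairwise distinct tangent lines), i.e.
the union is locally analytically a union of lines in general position.\<close>
definition ordinary_sing :: "nat \<Rightarrow> nat \<Rightarrow> (nat \<Rightarrow> hpoly) \<Rightarrow> bool" where
  "ordinary_sing d k F \<longleftrightarrow> (\<forall>p. union_singular d k F p \<longrightarrow>
     (\<forall>i<k. \<forall>j<k. i \<noteq> j \<longrightarrow> heval d (F i) p = 0 \<longrightarrow> heval d (F j) p = 0 \<longrightarrow>
        (\<forall>t. hgrad d (F i) p \<noteq> scal t (hgrad d (F j) p))))"

definition d_arrangement :: "nat \<Rightarrow> nat \<Rightarrow> (nat \<Rightarrow> hpoly) \<Rightarrow> bool" where
  "d_arrangement d k F \<longleftrightarrow> k \<ge> 3 \<and> d \<ge> 1 \<and>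
     (\<forall>j<k. smooth_curve d (F j)) \<and>
     inj_on (\<lambda>j. zero_set d (F j)) {..<k} \<and>
     ordinary_sing d k F"

definition levi_vertices :: "nat \<Rightarrow> nat \<Rightarrow> (nat \<Rightarrow> hpoly) \<Rightarrow> (cpt set + nat) set" where
  "levi_vertices d k F = Inl ` Sing d k F \<union> Inr ` {..<k}"

definition levi_edge :: "nat \<Rightarrow> nat \<Rightarrow> (nat \<Rightarrow> hpoly) \<Rightarrow> (cpt set + nat) \<Rightarrow> (cpt set + nat) \<Rightarrow> bool" where
  "levi_edge d k F u w \<longleftrightarrow>
     (\<exists>P j. P \<in> Sing d k F \<and> j < k \<and> P \<subseteq> zero_set d (F j) \<and>
        ({u, w} = {Inl P, Inr j}))"

definition is_ideal :: "'a::comm_ring_1 set \<Rightarrow> bool" where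
  "is_ideal I \<longleftrightarrow> 0 \<in> I \<and> (\<forall>x\<in>I. \<forall>y\<in>I. x + y \<in> I) \<and> (\<forall>r. \<forall>x\<in>I. r * x \<in> I)"

definition ideal_span :: "'a::comm_ring_1 set \<Rightarrow> 'a set" where
  "ideal_span G = \<Inter>{I. is_ideal I \<and> G \<subseteq> I}"

definition is_prime_ideal :: "'a::comm_ring_1 set \<Rightarrow> bool" where
  "is_prime_ideal P \<longleftrightarrow> is_ideal P \<and> P \<noteq> UNIV \<and> (\<forall>a b. a * b \<in> P \<longrightarrow> a \<in> P \<or> b \<in> P)"

definition is_maximal_ideal :: "'a::comm_ring_1 set \<Rightarrow> bool" where
  "is_maximal_ideal M \<longleftrightarrow> is_ideal M \<and> M \<noteq> UNIV \<and>
     (\<forall>I. is_ideal I \<and> M \<subseteq> I \<longrightarrow> I = M \<or> I = UNIV)"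

text \<open>Krull dimension of the local ring (R/J)_M: supremum of lengths r of chains
P_0 \<subset> ... \<subset> P_r of primes with J \<subseteq> P_0 and P_r \<subseteq> M.\<close>
definition local_dim :: "'a::comm_ring_1 set \<Rightarrow> 'a set \<Rightarrow> enat" where
  "local_dim J M = Sup {enat r | r. \<exists>P :: nat \<Rightarrow> 'a set.
      (\<forall>i\<le>r. is_prime_ideal (P i)) \<and> J \<subseteq> P 0 \<and> (\<forall>i<r. P i \<subset> P (Suc i)) \<and> P r \<subseteq> M}"

text \<open>f is a nonzerodivisor on (R/I)_M.\<close>
definition nzd_local :: "'a::comm_ring_1 set \<Rightarrow> 'a set \<Rightarrow> 'a \<Rightarrow> bool" where
  "nzd_local I M f \<longleftrightarrow> (\<forall>g. (\<exists>u. u \<notin> M \<and> u * f * g \<in> I) \<longrightarrow> (\<exists>s. s \<notin> M \<and> s * g \<in> I))"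

text \<open>Depth of the local ring (R/J)_M: supremum of lengths of (R/J)_M-regular
sequences in its maximal ideal (numerators chosen in M, w.l.o.g.).\<close>
definition local_depth :: "'a::comm_ring_1 set \<Rightarrow> 'a set \<Rightarrow> enat" where
  "local_depth J M = Sup {enat r | r. \<exists>f :: nat \<Rightarrow> 'a.
      (\<forall>i<r. f i \<in> M \<and> nzd_local (ideal_span (J \<union> f ` {..<i})) M (f i))}"

definition cohen_macaulay_quot :: "'a::comm_ring_1 set \<Rightarrow> bool" where
  "cohen_macaulay_quot J \<longleftrightarrow> (\<forall>M. is_maximal_ideal M \<and> J \<subseteq> M \<longrightarrow>
      local_depth J M = local_dim J M)"

text \<open>Polynomial ring K[a_v, b_v : v \<in> 'n]: variable (True,v) is a_v, (False,v) is b_v.\<close>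
type_synonym ('n, 'k) bpoly = "((bool \<times> 'n) \<Rightarrow>\<^sub>0 nat) \<Rightarrow>\<^sub>0 'k"

definition Var :: "bool \<times> 'n \<Rightarrow> ('n, 'k::field) bpoly" where
  "Var x = Poly_Mapping.single (Poly_Mapping.single x 1) 1"

definition binomial_edge_ideal :: "('n \<Rightarrow> 'n \<Rightarrow> bool) \<Rightarrow> ('n, 'k::field) bpoly set" where
  "binomial_edge_ideal E = ideal_span
     {Var (True, i) * Var (False, j) - Var (True, j) * Var (False, i) | i j. E i j}"

end

theory Submission
  imports Defs "HOL-Computational_Algebra.Fundamental_Theorem_Algebra" "Jordan_Normal_Form.Determinant"
begin

text \<open>If \<open>S/J\<close> were Cohen--Macaulay, then at the origin its dimension would equal its depth,
which is at most the dimension of every irreducible component through the origin. The components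
of \<open>J\<close> come from deleting a set of vertices and taking rank-one matrices on the connected
components of what remains. With \<open>s\<close> points and \<open>k\<close> curves, deleting nothing gives a
prime of dimension at least \<open>s + k + 1\<close>, deleting all points gives dimension \<open>2 k\<close>, and
deleting all curves gives dimension \<open>2 s\<close>; these cannot agree. Deleting all curves yields a
component only if each curve carries at least two points. A curve with just one point \<open>p\<close>
forces all curves through \<open>p\<close>, since any two curves meet; then one deletes only the curves with
two or more points and compares with the deletion of \<open>p\<close>.

The depth bound is elementary: the elements of a regular sequence are algebraically independent
over the ground field modulo any prime associated with \<open>J\<close>.\<close>

section \<open>Regular sequences and torsion\<close>

text \<open>Only one inequality is proved on each side: a lower bound for the dimension and an upper
  bound for the depth, both at the origin. The first needs just an explicit chain of primes over
  \<open>J\<close>. The second needs a prime \<open>P\<close> over \<open>J\<close> such that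
  \<open>J\<close> and \<open>P\<close> agree in the local ring at \<open>P\<close>, that is, every
  element of \<open>P\<close> is multiplied into \<open>J\<close> by some element outside
  \<open>P\<close>; so no primary decomposition of \<open>J\<close> has to be known. Every prime
  that occurs has a single rank-one block \<open>W\<close>, free columns \<open>U\<close> and zero
  columns elsewhere. It is therefore the kernel of a monomial map, and primality, chains and
  counting all reduce to statements about exponents. Torsion-freeness in the local ring at the
  origin replaces the usual theory of depth and associated primes; its only input from commutative
  algebra is the maximal condition on ideals.\<close>

lemma is_idealD:
  assumes "is_ideal I"
  shows "0 \<in> I" "x \<in> I \<Longrightarrow> y \<in> I \<Longrightarrow> x + y \<in> I" "x \<in> I \<Longrightarrow> r * x \<in> I"
    "x \<in> I \<Longrightarrow> x * r \<in> I" "x \<in> I \<Longrightarrow> - x \<in> I" "x \<in> I \<Longrightarrow> y \<in> I \<Longrightarrow> x - y \<in> I"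
proof -
  note I = assms[unfolded is_ideal_def]
  show "0 \<in> I" "x \<in> I \<Longrightarrow> y \<in> I \<Longrightarrow> x + y \<in> I" "x \<in> I \<Longrightarrow> r * x \<in> I"
    using I by auto
  show "x \<in> I \<Longrightarrow> x * r \<in> I" using I by (metis mult.commute)
  show neg: "x \<in> I \<Longrightarrow> - x \<in> I" for x using I by (metis mult_minus1)
  show "x \<in> I \<Longrightarrow> y \<in> I \<Longrightarrow> x - y \<in> I" using I neg[of y] by (metis diff_conv_add_uminus)
qed

lemma ideal_sum_mem: "is_ideal I \<Longrightarrow> (\<And>x. x \<in> A \<Longrightarrow> f x \<in> I) \<Longrightarrow> sum f A \<in> I"
  by (induction A rule: infinite_finite_induct) (auto intro: is_idealD)

lemma is_ideal_span: "is_ideal (ideal_span G)"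
  unfolding is_ideal_def ideal_span_def by auto

lemma ideal_span_superset: "G \<subseteq> ideal_span G"
  unfolding ideal_span_def by auto

lemma ideal_span_minimal: "is_ideal I \<Longrightarrow> G \<subseteq> I \<Longrightarrow> ideal_span G \<subseteq> I"
  unfolding ideal_span_def by auto

definition adjoin :: "'a::comm_ring_1 set \<Rightarrow> 'a \<Rightarrow> 'a set" where
  "adjoin I a = {x + r * a | x r. x \<in> I}"

lemma adjoin_iff: "g \<in> adjoin I a \<longleftrightarrow> (\<exists>r. g - r * a \<in> I)"
proof
  assume "\<exists>r. g - r * a \<in> I"
  then obtain r where "g - r * a \<in> I" by auto
  moreover have "g = (g - r * a) + r * a" by simp
  ultimately show "g \<in> adjoin I a" unfolding adjoin_def by blast
next
  assume "g \<in> adjoin I a"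
  then obtain x r where "x \<in> I" "g = x + r * a" unfolding adjoin_def by auto
  then show "\<exists>r. g - r * a \<in> I" by (intro exI[of _ r]) simp
qed

lemma is_ideal_adjoin: assumes "is_ideal I" shows "is_ideal (adjoin I a)"
  unfolding is_ideal_def
proof (intro conjI ballI allI)
  show "0 \<in> adjoin I a" using is_idealD(1)[OF assms] unfolding adjoin_iff by (intro exI[of _ 0]) simp
  fix x y assume "x \<in> adjoin I a"
  then obtain r where r: "x - r * a \<in> I" unfolding adjoin_iff by auto
  { assume "y \<in> adjoin I a"
    then obtain s where s: "y - s * a \<in> I" unfolding adjoin_iff by auto
    have "(x + y) - (r + s) * a = (x - r * a) + (y - s * a)" by (simp add: algebra_simps)
    then show "x + y \<in> adjoin I a" unfolding adjoin_iff using is_idealD(2)[OF assms r s] by metis }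
  have "y * x - (y * r) * a = y * (x - r * a)" by (simp add: algebra_simps)
  then show "y * x \<in> adjoin I a" unfolding adjoin_iff using is_idealD(3)[OF assms r] by metis
qed

lemma adjoin_superset:
  assumes "is_ideal I"
  shows "I \<subseteq> adjoin I a" "a \<in> adjoin I a"
proof -
  show "I \<subseteq> adjoin I a"
  proof
    fix x assume "x \<in> I"
    then show "x \<in> adjoin I a" unfolding adjoin_iff by (intro exI[of _ 0]) simp
  qed
  show "a \<in> adjoin I a" unfolding adjoin_iff
    by (intro exI[of _ 1]) (simp add: is_idealD(1)[OF assms])
qed

lemma ideal_span_insert_subset: "ideal_span (insert a G) \<subseteq> adjoin (ideal_span G) a"
  using adjoin_superset[OF is_ideal_span[of G], of a] ideal_span_superset[of G]
  by (intro ideal_span_minimal is_ideal_adjoin is_ideal_span) auto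

text \<open>For prime \<open>M\<close> and an ideal \<open>I\<close> this is the contraction of the
  localized ideal to the ring. Statements about the local ring become statements about such
  contractions, so no ring of fractions has to be built.\<close>

definition saturation :: "'a::comm_ring_1 set \<Rightarrow> 'a set \<Rightarrow> 'a set" where
  "saturation M I = {g. \<exists>u. u \<notin> M \<and> u * g \<in> I}"

lemma saturation_mono: "I \<subseteq> I' \<Longrightarrow> saturation M I \<subseteq> saturation M I'"
  unfolding saturation_def by blast

lemma prime_not_in_mult: "is_prime_ideal M \<Longrightarrow> u \<notin> M \<Longrightarrow> v \<notin> M \<Longrightarrow> u * v \<notin> M"
  unfolding is_prime_ideal_def by blast

lemma prime_one_not_in: assumes "is_prime_ideal M" shows "1 \<notin> M"
proof
  assume "1 \<in> M"
  then have "x \<in> M" for x using assms is_idealD(3)[of M 1 x] unfolding is_prime_ideal_def by simp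
  then show False using assms unfolding is_prime_ideal_def by blast
qed

lemma saturation_superset: "is_prime_ideal M \<Longrightarrow> I \<subseteq> saturation M I"
  unfolding saturation_def using prime_one_not_in by force

lemma is_ideal_saturation:
  assumes M: "is_prime_ideal M" and I: "is_ideal I"
  shows "is_ideal (saturation M I)"
  unfolding is_ideal_def
proof (intro conjI ballI allI)
  show "0 \<in> saturation M I" using saturation_superset[OF M] is_idealD(1)[OF I] by blast
  fix x y assume "x \<in> saturation M I"
  then obtain u where u: "u \<notin> M" "u * x \<in> I" unfolding saturation_def by auto
  { assume "y \<in> saturation M I"
    then obtain v where v: "v \<notin> M" "v * y \<in> I" unfolding saturation_def by auto
    have "(u * v) * (x + y) = v * (u * x) + u * (v * y)" by (simp add: algebra_simps)
    then have "(u * v) * (x + y) \<in> I" using is_idealD(2,3)[OF I] u v by metis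
    then show "x + y \<in> saturation M I" unfolding saturation_def
      using prime_not_in_mult[OF M u(1) v(1)] by blast }
  have "u * (y * x) = y * (u * x)" by (simp add: algebra_simps)
  then show "y * x \<in> saturation M I" unfolding saturation_def using u(1) is_idealD(3)[OF I u(2), of y] by (auto simp: mult.left_commute)
qed

lemma saturation_idem:
  assumes "is_prime_ideal M" shows "saturation M (saturation M I) = saturation M I"
proof
  show "saturation M (saturation M I) \<subseteq> saturation M I"
  proof
    fix x assume "x \<in> saturation M (saturation M I)"
    then obtain u v where "u \<notin> M" "v \<notin> M" "v * (u * x) \<in> I" unfolding saturation_def by auto
    then show "x \<in> saturation M I" unfolding saturation_def
      using prime_not_in_mult[OF assms, of v u] by (auto simp: mult.assoc)
  qed
qed (rule saturation_superset[OF assms])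

lemma nzd_local_iff:
  "nzd_local I M f \<longleftrightarrow> (\<forall>g. f * g \<in> saturation M I \<longrightarrow> g \<in> saturation M I)"
  unfolding nzd_local_def saturation_def by (auto simp: mult.assoc)

definition noetherian :: "'a::comm_ring_1 itself \<Rightarrow> bool" where
  "noetherian _ \<longleftrightarrow> (\<forall>A::'a set set. A \<noteq> {} \<longrightarrow> (\<forall>I\<in>A. is_ideal I) \<longrightarrow>
     (\<exists>I\<in>A. \<forall>I'\<in>A. I \<subseteq> I' \<longrightarrow> I' = I))"

text \<open>Locally, the elements annihilated by \<open>h + f * y\<close> modulo \<open>I\<close>
  form a module \<open>N\<close> with \<open>N = f N\<close>, because \<open>h\<close> is regular
  modulo \<open>f\<close>; Nakayama's lemma gives \<open>N = 0\<close>. The proof replaces Nakayama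
  by choosing an annihilated element that generates a maximal ideal over \<open>I\<close>.\<close>

lemma torsion_free_step:
  fixes M I :: "'a::comm_ring_1 set"
  assumes N: "noetherian TYPE('a)" and M: "is_prime_ideal M" and I: "is_ideal I"
    and sat: "saturation M I = I" and fM: "f \<in> M" and nz: "\<And>g. f * g \<in> I \<Longrightarrow> g \<in> I"
    and h: "\<And>w. h * w \<in> saturation M (adjoin I f) \<Longrightarrow> w \<in> saturation M (adjoin I f)"
    and w: "(h + f * y) * w \<in> I"
  shows "w \<in> I"
proof (rule ccontr)
  assume wI: "w \<notin> I"
  define S where "S = {w. (h + f * y) * w \<in> I \<and> w \<notin> I}"
  define \<A> where "\<A> = (\<lambda>w. saturation M (adjoin I w)) ` S"
  have "\<exists>A\<in>\<A>. \<forall>B\<in>\<A>. A \<subseteq> B \<longrightarrow> B = A"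
  proof -
    have "\<A> \<noteq> {}" unfolding \<A>_def S_def using w wI by blast
    moreover have "\<forall>A\<in>\<A>. is_ideal A"
      unfolding \<A>_def by (auto intro: is_ideal_saturation[OF M] is_ideal_adjoin I)
    ultimately show ?thesis using N unfolding noetherian_def by blast
  qed
  then obtain v where v: "v \<in> S"
    and max: "\<And>v'. v' \<in> S \<Longrightarrow> saturation M (adjoin I v) \<subseteq> saturation M (adjoin I v')
      \<Longrightarrow> saturation M (adjoin I v') = saturation M (adjoin I v)"
    unfolding \<A>_def by blast
  have "h * v = (h + f * y) * v - (y * v) * f" by (simp add: algebra_simps)
  moreover have "(h + f * y) * v \<in> I" using v by (simp add: S_def)
  ultimately have "h * v - (- (y * v)) * f \<in> I" by simp
  then have "h * v \<in> adjoin I f" unfolding adjoin_iff by blast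
  then have "v \<in> saturation M (adjoin I f)" using h saturation_superset[OF M] by blast
  \<comment> \<open>Locally \<open>v\<close> equals \<open>f * v'\<close> modulo \<open>I\<close> up
    to a unit, so \<open>v'\<close> generates at least as much as \<open>v\<close>, and it turns out
    to be annihilated as well.\<close>
  then obtain u v' where u: "u \<notin> M" "u * v - v' * f \<in> I"
    unfolding saturation_def adjoin_iff by auto
  have v'S: "v' \<in> S"
  proof -
    have "f * ((h + f * y) * v') = u * ((h + f * y) * v) - (h + f * y) * (u * v - v' * f)"
      by (simp add: algebra_simps)
    also have "\<dots> \<in> I"
      using u v unfolding S_def by (auto intro: is_idealD(6)[OF I is_idealD(3)[OF I] is_idealD(3)[OF I]])
    finally have 1: "(h + f * y) * v' \<in> I" by (rule nz)
    have "v' \<notin> I"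
    proof
      assume "v' \<in> I"
      have "u * v = (u * v - v' * f) + f * v'" by (simp add: algebra_simps)
      also have "\<dots> \<in> I" by (rule is_idealD(2)[OF I u(2) is_idealD(3)[OF I \<open>v' \<in> I\<close>]])
      finally have "v \<in> saturation M I" unfolding saturation_def using u by auto
      then show False using v sat by (auto simp: S_def)
    qed
    with 1 show ?thesis by (simp add: S_def)
  qed
  have "saturation M (adjoin I v) \<subseteq> saturation M (adjoin I v')"
  proof
    fix x assume "x \<in> saturation M (adjoin I v)"
    then obtain t r where t: "t \<notin> M" "t * x - r * v \<in> I"
      unfolding saturation_def adjoin_iff by auto
    have "(u * t) * x - (r * f) * v' = u * (t * x - r * v) + r * (u * v - v' * f)"
      by (simp add: algebra_simps)
    also have "\<dots> \<in> I" by (rule is_idealD(2)[OF I is_idealD(3)[OF I t(2)] is_idealD(3)[OF I u(2)]])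
    finally show "x \<in> saturation M (adjoin I v')"
      unfolding saturation_def adjoin_iff using prime_not_in_mult[OF M u(1) t(1)] by blast
  qed
  then have "v' \<in> saturation M (adjoin I v)"
    using max[OF v'S] adjoin_superset(2)[OF I, of v'] saturation_superset[OF M] by blast
  then obtain t r where t: "t \<notin> M" "t * v' - r * v \<in> I"
    unfolding saturation_def adjoin_iff by auto
  \<comment> \<open>By maximality \<open>v'\<close> is in turn a multiple of \<open>v\<close>, hence
    of \<open>f * v'\<close>. The cofactor \<open>u * t - r * f\<close> is a unit at
    \<open>M\<close>, since \<open>f\<close> lies in \<open>M\<close> and \<open>u * t\<close> does
    not.\<close>
  have "(u * t - r * f) * v' = u * (t * v' - r * v) + r * (u * v - v' * f)"
    by (simp add: algebra_simps)
  also have "\<dots> \<in> I" by (rule is_idealD(2)[OF I is_idealD(3)[OF I t(2)] is_idealD(3)[OF I u(2)]])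
  finally have "(u * t - r * f) * v' \<in> I" .
  moreover have "u * t - r * f \<notin> M"
  proof
    assume "u * t - r * f \<in> M"
    have iM: "is_ideal M" using M by (simp add: is_prime_ideal_def)
    have "(u * t - r * f) + r * f \<in> M"
      by (rule is_idealD(2)[OF iM \<open>u * t - r * f \<in> M\<close> is_idealD(3)[OF iM fM]])
    then show False using prime_not_in_mult[OF M u(1) t(1)] by simp
  qed
  ultimately have "v' \<in> saturation M I" unfolding saturation_def by blast
  then show False using v'S sat by (auto simp: S_def)
qed

text \<open>Every nonzero polynomial in \<open>f i, \<dots>, f (r - 1)\<close> with coefficients that are zero
or outside \<open>M\<close> has this shape (factor out the largest possible power of \<open>f i\<close>), and
this shape is all that torsion-freeness needs.\<close>
inductive nonzero_expr :: "'a::comm_ring_1 set \<Rightarrow> (nat \<Rightarrow> 'a) \<Rightarrow> nat \<Rightarrow> nat \<Rightarrow> 'a \<Rightarrow> bool"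
  for M f r where
  unit: "x \<notin> M \<Longrightarrow> nonzero_expr M f r r x"
| step: "nonzero_expr M f r (Suc i) h \<Longrightarrow> i < r \<Longrightarrow>
    nonzero_expr M f r i (f i ^ e * (h + f i * y))"

text \<open>At level \<open>r\<close> the expression is a unit at \<open>M\<close>. At level
  \<open>i\<close> the power of \<open>f i\<close> cancels by regularity, and
  \<open>torsion_free_step\<close> lifts the claim for \<open>h\<close> modulo \<open>f i\<close> to
  \<open>h + f i * y\<close>.\<close>

lemma torsion_free:
  fixes M J :: "'a::comm_ring_1 set"
  assumes N: "noetherian TYPE('a)" and M: "is_prime_ideal M"
    and reg: "\<forall>i<r. f i \<in> M \<and> nzd_local (ideal_span (J \<union> f ` {..<i})) M (f i)"
    and "nonzero_expr M f r i x"
    and "x * w \<in> saturation M (ideal_span (J \<union> f ` {..<i}))"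
  shows "w \<in> saturation M (ideal_span (J \<union> f ` {..<i}))"
  using assms(4,5)
proof (induction arbitrary: w rule: nonzero_expr.induct)
  case (unit x)
  then have "w \<in> saturation M (saturation M (ideal_span (J \<union> f ` {..<r})))"
    unfolding saturation_def[of M "saturation M _"] by blast
  then show ?case using saturation_idem[OF M] by blast
next
  case (step i h e y)
  define I where "I = saturation M (ideal_span (J \<union> f ` {..<i}))"
  define I' where "I' = saturation M (ideal_span (J \<union> f ` {..<Suc i}))"
  have I: "is_ideal I" unfolding I_def by (intro is_ideal_saturation M is_ideal_span)
  have nz: "\<And>g. f i * g \<in> I \<Longrightarrow> g \<in> I"
    using reg step.hyps(2) unfolding nzd_local_iff I_def by blast
  have "J \<union> f ` {..<Suc i} = insert (f i) (J \<union> f ` {..<i})" by (auto simp: lessThan_Suc)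
  then have "ideal_span (J \<union> f ` {..<Suc i}) \<subseteq> adjoin (ideal_span (J \<union> f ` {..<i})) (f i)"
    using ideal_span_insert_subset[of "f i" "J \<union> f ` {..<i}"] by simp
  also have "\<dots> \<subseteq> adjoin I (f i)"
    unfolding I_def adjoin_def using saturation_superset[OF M] by blast
  finally have "I' \<subseteq> saturation M (adjoin I (f i))" unfolding I'_def by (rule saturation_mono)
  moreover have "adjoin I (f i) \<subseteq> I'"
  proof -
    have I': "is_ideal I'" unfolding I'_def by (intro is_ideal_saturation M is_ideal_span)
    have "I \<subseteq> I'" unfolding I_def I'_def
      by (intro saturation_mono ideal_span_minimal is_ideal_span
          order_trans[OF _ ideal_span_superset]) auto
    moreover have "f i \<in> I'"
      using ideal_span_superset[of "J \<union> f ` {..<Suc i}"] saturation_superset[OF M]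
      unfolding I'_def by blast
    ultimately show ?thesis unfolding adjoin_def by (auto intro!: is_idealD(2,3)[OF I'])
  qed
  then have "saturation M (adjoin I (f i)) \<subseteq> I'"
    using saturation_mono saturation_idem[OF M] unfolding I'_def by metis
  \<comment> \<open>\<open>torsion_free_step\<close> adjoins \<open>f i\<close> to the contraction,
    the induction hypothesis to the ideal itself; after saturation both give the same ideal.\<close>
  ultimately have eq: "saturation M (adjoin I (f i)) = I'" by blast
  have "f i ^ e * ((h + f i * y) * w) \<in> I" using step.prems unfolding I_def by (simp add: mult.assoc)
  then have "(h + f i * y) * w \<in> I"
  proof (induction e)
    case (Suc e) then show ?case using nz by (simp add: mult.assoc)
  qed simp
  then have "w \<in> I"
  proof (rule torsion_free_step[OF N M I _ _ nz, rotated -1])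
    show "saturation M I = I" unfolding I_def by (rule saturation_idem[OF M])
    show "f i \<in> M" using reg step.hyps(2) by blast
    show "w \<in> saturation M (adjoin I (f i))" if "h * w \<in> saturation M (adjoin I (f i))" for w
      using step.IH[of w] that unfolding eq I'_def .
  qed
  then show ?case unfolding I_def .
qed

lemma nonzero_expr_sum:
  fixes C :: "'k::zero \<Rightarrow> 'a::comm_ring_1"
  assumes C: "\<And>c. c \<noteq> 0 \<Longrightarrow> C c \<notin> M" "C 0 = 0"
    and "i \<le> r" and "\<exists>\<alpha>\<in>PiE {i..<r} (\<lambda>_. {..t}). c \<alpha> \<noteq> 0"
  shows "nonzero_expr M f r i
    (\<Sum>\<alpha>\<in>PiE {i..<r} (\<lambda>_. {..t::nat}). C (c \<alpha>) * (\<Prod>j\<in>{i..<r}. f j ^ \<alpha> j))"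
  using assms(3,4)
proof (induction i arbitrary: c rule: inc_induct)
  case base
  then show ?case using C by (auto intro!: nonzero_expr.unit)
next
  case (step i)
  let ?B = "PiE {Suc i..<r} (\<lambda>_. {..t})"
  have ir: "{i..<r} = insert i {Suc i..<r}" using step.hyps by auto
  define S where "S e = (\<Sum>\<beta>\<in>?B. C (c (\<beta>(i := e))) * (\<Prod>j\<in>{Suc i..<r}. f j ^ \<beta> j))" for e
  have inj: "inj_on (\<lambda>(e, \<beta>). \<beta>(i := e)) ({..t} \<times> ?B)"
    by (rule inj_combinator) simp
  have "(\<Sum>\<alpha>\<in>PiE {i..<r} (\<lambda>_. {..t}). C (c \<alpha>) * (\<Prod>j\<in>{i..<r}. f j ^ \<alpha> j)) =
     (\<Sum>(e, \<beta>)\<in>{..t} \<times> ?B. C (c (\<beta>(i := e))) * (\<Prod>j\<in>{i..<r}. f j ^ (\<beta>(i := e)) j))"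
    unfolding ir PiE_insert_eq by (subst sum.reindex[OF inj]) (simp add: case_prod_unfold)
  also have "\<dots> = (\<Sum>(e, \<beta>)\<in>{..t} \<times> ?B. f i ^ e *
      (C (c (\<beta>(i := e))) * (\<Prod>j\<in>{Suc i..<r}. f j ^ \<beta> j)))"
  proof (rule sum.cong[OF refl], clarify)
    fix e and \<beta> :: "nat \<Rightarrow> nat"
    have "(\<Prod>j\<in>{Suc i..<r}. f j ^ (\<beta>(i := e)) j) = (\<Prod>j\<in>{Suc i..<r}. f j ^ \<beta> j)"
      by (rule prod.cong) auto
    then show "C (c (\<beta>(i := e))) * (\<Prod>j\<in>{i..<r}. f j ^ (\<beta>(i := e)) j) = f i ^ e *
      (C (c (\<beta>(i := e))) * (\<Prod>j\<in>{Suc i..<r}. f j ^ \<beta> j))"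
      unfolding ir by (simp add: algebra_simps)
  qed
  also have "\<dots> = (\<Sum>e\<le>t. f i ^ e * S e)"
    unfolding S_def by (simp add: sum.cartesian_product sum_distrib_left)
  finally have eq: "(\<Sum>\<alpha>\<in>PiE {i..<r} (\<lambda>_. {..t}). C (c \<alpha>) * (\<Prod>j\<in>{i..<r}. f j ^ \<alpha> j)) =
     (\<Sum>e\<le>t. f i ^ e * S e)" .
  define Q where "Q e \<longleftrightarrow> e \<le> t \<and> (\<exists>\<beta>\<in>?B. c (\<beta>(i := e)) \<noteq> 0)" for e
  obtain \<alpha> where \<alpha>: "\<alpha> \<in> PiE {i..<r} (\<lambda>_. {..t})" "c \<alpha> \<noteq> 0" using step.prems by blast
  then have "\<alpha> \<in> (\<lambda>(e, \<beta>). \<beta>(i := e)) ` ({..t} \<times> ?B)" unfolding ir PiE_insert_eq by blast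
  then obtain e0 \<beta>0 where "\<alpha> = \<beta>0(i := e0)" "e0 \<le> t" "\<beta>0 \<in> ?B" by auto
  then have "Q e0" using \<alpha>(2) unfolding Q_def by auto
  then have "\<exists>e. Q e" ..
  define e where "e = (LEAST e. Q e)"
  have Qe: "Q e" unfolding e_def using \<open>\<exists>e. Q e\<close> by (rule LeastI_ex)
  have S0: "S e' = 0" if "e' < e" for e'
  proof -
    have "\<not> Q e'" using not_less_Least that unfolding e_def by blast
    moreover have "e' \<le> t" using that Qe by (simp add: Q_def)
    ultimately show ?thesis unfolding S_def Q_def using C(2) by (auto intro!: sum.neutral)
  qed
  have "(\<Sum>e\<le>t. f i ^ e * S e) = (\<Sum>e'\<in>{e..t}. f i ^ e' * S e')"
    using Qe by (intro sum.mono_neutral_right) (auto simp: S0 not_le)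
  also have "\<dots> = f i ^ e * S e + (\<Sum>e'\<in>{Suc e..t}. f i ^ e' * S e')"
    using Qe by (simp add: Q_def sum.atLeast_Suc_atMost)
  also have "(\<Sum>e'\<in>{Suc e..t}. f i ^ e' * S e') =
      f i ^ e * (f i * (\<Sum>e'\<in>{Suc e..t}. f i ^ (e' - Suc e) * S e'))"
    unfolding sum_distrib_left
  proof (rule sum.cong[OF refl])
    fix e' assume "e' \<in> {Suc e..t}"
    then have "f i ^ e' = f i ^ e * f i ^ Suc (e' - Suc e)"
      unfolding power_add[symmetric] by auto
    then show "f i ^ e' * S e' = f i ^ e * (f i * (f i ^ (e' - Suc e) * S e'))"
      by (simp add: mult.assoc)
  qed
  finally have eq2: "(\<Sum>e\<le>t. f i ^ e * S e) =
    f i ^ e * (S e + f i * (\<Sum>e'\<in>{Suc e..t}. f i ^ (e' - Suc e) * S e'))"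
    by (simp add: distrib_left)
  have "nonzero_expr M f r (Suc i) (S e)"
    unfolding S_def using Qe step.IH[of "\<lambda>\<beta>. c (\<beta>(i := e))"] unfolding Q_def by blast
  then show ?case unfolding eq eq2 using step.hyps by (intro nonzero_expr.step) auto
qed

section \<open>Polynomial rings are Noetherian\<close>

abbreviation "lookup \<equiv> Poly_Mapping.lookup"
abbreviation "keys \<equiv> Poly_Mapping.keys"
abbreviation "single \<equiv> Poly_Mapping.single"

section \<open>Weights and the monomial order\<close>

definition index :: "'x::finite \<Rightarrow> nat" where
  "index = (SOME f. inj f)"

lemma inj_index: "inj (index :: 'x::finite \<Rightarrow> nat)"
proof -
  have "\<exists>f :: 'x \<Rightarrow> nat. inj f"
    using finite_imp_inj_to_nat_seg[of "UNIV :: 'x set"] by auto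
  then show ?thesis unfolding index_def by (rule someI_ex)
qed

text \<open>The monomial map sending the variable \<open>x\<close> to the product of the variables in \<open>S x\<close>,
on the level of exponents.\<close>
definition expo :: "('x::finite \<Rightarrow> 'x set) \<Rightarrow> ('x \<Rightarrow>\<^sub>0 nat) \<Rightarrow> 'x \<Rightarrow> nat" where
  "expo S m j = (\<Sum>x | j \<in> S x. lookup m x)"

text \<open>Exponents are encoded by integer polynomials because these form a linearly ordered
additive group, whose group algebra is therefore an integral domain.\<close>
definition weight :: "('x::finite \<Rightarrow> 'x set) \<Rightarrow> ('x \<Rightarrow>\<^sub>0 nat) \<Rightarrow> int poly" where
  "weight S m = (\<Sum>j\<in>UNIV. monom (int (expo S m j)) (index j))"

lemma coeff_weight: "coeff (weight S m) (index j) = int (expo S m j)"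
proof -
  have "coeff (weight S m) (index j) = (\<Sum>i\<in>UNIV. if i = j then int (expo S m i) else 0)"
    unfolding weight_def coeff_sum
    by (rule sum.cong) (auto simp: inj_eq[OF inj_index])
  then show ?thesis by simp
qed

lemma expo_add: "expo S (m + n) j = expo S m j + expo S n j"
  unfolding expo_def by (simp add: lookup_add sum.distrib)

lemma weight_add: "weight S (m + n) = weight S m + weight S n"
  unfolding weight_def by (simp add: expo_add add_monom[symmetric] sum.distrib)

lemma weight_0 [simp]: "weight S 0 = 0"
  unfolding weight_def expo_def by simp

lemma weight_eq_iff: "weight S m = weight S n \<longleftrightarrow> expo S m = expo S n"
proof
  assume "weight S m = weight S n"
  then have "int (expo S m j) = int (expo S n j)" for j
    unfolding coeff_weight[symmetric] by simp
  then show "expo S m = expo S n" by auto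
qed (simp add: weight_def)

lemma weight_nonneg: "0 \<le> weight S m"
proof -
  have "0 \<le> monom (int a) i" for a i
    by (cases "a = 0") (auto simp: less_eq_poly_def pos_poly_def degree_monom_eq)
  then show ?thesis unfolding weight_def by (intro sum_nonneg)
qed

text \<open>With singleton labels the weight is injective and additive. Integer polynomials are
  ordered by the leading coefficient of the difference, so this is a lexicographic monomial order in
  which the variable of largest \<open>index\<close> decides first.\<close>

abbreviation "wt \<equiv> weight (\<lambda>x. {x})"

lemma inj_wt:
  fixes m n :: "'x::finite \<Rightarrow>\<^sub>0 nat"
  shows "wt m = wt n \<longleftrightarrow> m = n"
proof -
  have "expo (\<lambda>x. {x}) m = lookup m" for m :: "'x \<Rightarrow>\<^sub>0 nat"
    unfolding expo_def by (rule ext) simp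
  then show ?thesis unfolding weight_eq_iff by (simp only: poly_mapping_eq_iff)
qed

text \<open>Every sequence has a monotone subsequence; if it decreases, it is constant from its
  least value on, and that tail also counts as increasing.\<close>

lemma nat_seq_mono_subseq:
  fixes s :: "nat \<Rightarrow> nat"
  shows "\<exists>f :: nat \<Rightarrow> nat. strict_mono f \<and> mono (\<lambda>n. s (f n))"
proof -
  obtain f :: "nat \<Rightarrow> nat" where f: "strict_mono f" "monoseq (\<lambda>n. s (f n))"
    using seq_monosub by blast
  show ?thesis
  proof (cases "mono (\<lambda>n. s (f n))")
    case False
    then have dec: "s (f n) \<le> s (f m)" if "m \<le> n" for m n
      using f(2) that unfolding monoseq_iff incseq_def decseq_def by auto
    define l where "l = (LEAST x. x \<in> range (\<lambda>n. s (f n)))"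
    have "l \<in> range (\<lambda>n. s (f n))" unfolding l_def by (rule LeastI) blast
    then obtain N where N: "s (f N) = l" by auto
    have "s (f (n + N)) = l" for n
      using dec[of N "n + N"] N Least_le[of "\<lambda>x. x \<in> range (\<lambda>n. s (f n))" "s (f (n + N))"]
      unfolding l_def by fastforce
    then have "mono (\<lambda>n. s (f (n + N)))" by (simp add: mono_def)
    moreover have "strict_mono (\<lambda>n. f (n + N))" using f(1) by (simp add: strict_mono_def)
    ultimately have "strict_mono (\<lambda>n. f (n + N)) \<and> mono (\<lambda>n. s (f (n + N)))" by blast
    then show ?thesis by (rule exI[of "\<lambda>f. strict_mono f \<and> mono (\<lambda>n. s (f n))"])
  qed (use f in blast)
qed

text \<open>Dickson's lemma: passing to a subsequence once per variable makes all exponents increase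
  simultaneously.\<close>

lemma dickson:
  fixes m :: "nat \<Rightarrow> 'x::finite \<Rightarrow>\<^sub>0 nat"
  shows "\<exists>i j. i < j \<and> (\<exists>d. m j = m i + d)"
proof -
  have "\<exists>f :: nat \<Rightarrow> nat. strict_mono f \<and> (\<forall>x\<in>A. mono (\<lambda>n. lookup (m (f n)) x))" if "finite A" for A :: "'x set"
    using that
  proof (induction A)
    case empty
    then show ?case by (intro exI[of _ id]) (simp add: strict_mono_def)
  next
    case (insert a A)
    then obtain f :: "nat \<Rightarrow> nat" where f: "strict_mono f" "\<forall>x\<in>A. mono (\<lambda>n. lookup (m (f n)) x)" by blast
    obtain g :: "nat \<Rightarrow> nat" where g: "strict_mono g" "mono (\<lambda>n. lookup (m (f (g n))) a)"
      using nat_seq_mono_subseq[of "\<lambda>n. lookup (m (f n)) a"] by blast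
    have "strict_mono (\<lambda>n. f (g n))" using f(1) g(1) by (simp add: strict_mono_def)
    moreover have "mono (\<lambda>n. lookup (m (f (g n))) x)" if "x \<in> A" for x
      using f(2) that strict_mono_mono[OF g(1)] unfolding mono_def by blast
    ultimately show ?case using g(2) by (intro exI[of _ "\<lambda>n. f (g n)"]) auto
  qed
  from this[OF finite_UNIV] obtain f :: "nat \<Rightarrow> nat" where
    f: "strict_mono f" "\<And>x. mono (\<lambda>n. lookup (m (f n)) x)" by blast
  have "lookup (m (f 0)) x \<le> lookup (m (f 1)) x" for x using f(2) by (auto simp: mono_def)
  then have "m (f 1) = m (f 0) + (m (f 1) - m (f 0))"
    by (auto intro!: poly_mapping_eqI simp: lookup_add lookup_minus)
  moreover have "f 0 < f 1" using f(1) by (simp add: strict_mono_def)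
  ultimately show ?thesis by blast
qed

text \<open>In a strictly decreasing sequence some monomial would divide a later one by
  \<open>dickson\<close>, and the later one would then have at least its weight.\<close>

lemma wf_wt: "wf {(m, n :: 'x::finite \<Rightarrow>\<^sub>0 nat). wt m < wt n}"
  unfolding wf_iff_no_infinite_down_chain
proof
  assume "\<exists>s. \<forall>i. (s (Suc i), s i) \<in> {(m, n :: 'x \<Rightarrow>\<^sub>0 nat). wt m < wt n}"
  then obtain s :: "nat \<Rightarrow> 'x \<Rightarrow>\<^sub>0 nat" where s: "wt (s (Suc i)) < wt (s i)" for i by auto
  have dec: "wt (s j) < wt (s i)" if "i < j" for i j
    using that by (induction rule: less_Suc_induct) (use s order.strict_trans in blast)+
  obtain i j d where "i < j" "s j = s i + d" using dickson[of s] by blast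
  then show False using dec[of i j] weight_nonneg[of "\<lambda>x. {x}" d] by (simp add: weight_add not_less[symmetric])
qed

definition lead_expo :: "(('x::finite \<Rightarrow>\<^sub>0 nat) \<Rightarrow>\<^sub>0 'k::zero) \<Rightarrow> 'x \<Rightarrow>\<^sub>0 nat" where
  "lead_expo p = (SOME m. m \<in> keys p \<and> (\<forall>n\<in>keys p. wt n \<le> wt m))"

lemma lead_expo:
  assumes "p \<noteq> 0"
  shows "lead_expo p \<in> keys p" "n \<in> keys p \<Longrightarrow> wt n \<le> wt (lead_expo p)"
proof -
  have "keys p \<noteq> {}" using assms by auto
  then have ne: "wt ` keys p \<noteq> {}" by blast
  have fin: "finite (wt ` keys p)" by simp
  obtain m where m: "m \<in> keys p" "wt m = Max (wt ` keys p)" using Max_in[OF fin ne] by auto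
  then have "m \<in> keys p \<and> (\<forall>n\<in>keys p. wt n \<le> wt m)" using Max_ge[OF fin] by auto
  then have "lead_expo p \<in> keys p \<and> (\<forall>n\<in>keys p. wt n \<le> wt (lead_expo p))"
    unfolding lead_expo_def by (rule someI)
  then show "lead_expo p \<in> keys p" "n \<in> keys p \<Longrightarrow> wt n \<le> wt (lead_expo p)" by auto
qed

lemma lookup_single_mult:
  fixes p :: "'a::cancel_comm_monoid_add \<Rightarrow>\<^sub>0 'k::comm_ring_1"
  shows "lookup (single d c * p) (d + m) = c * lookup p m"
    and "keys (single d c * p) \<subseteq> (+) d ` keys p"
proof -
  have "lookup (single d c * p) (d + m) = (\<Sum>l. (c when d = l) * (\<Sum>q. lookup p q when d + m = l + q))"
    by (simp add: lookup_mult lookup_single)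
  also have "\<dots> = c * lookup p m" by (simp add: when_mult)
  finally show "lookup (single d c * p) (d + m) = c * lookup p m" .
  show "keys (single d c * p) \<subseteq> (+) d ` keys p"
  proof
    fix x assume "x \<in> keys (single d c * p)"
    then show "x \<in> (+) d ` keys p"
      using keys_mult[of "single d c" p] by (auto split: if_splits)
  qed
qed

text \<open>In a strictly increasing chain of ideals, choose at each jump a new element with least
  leading monomial. By \<open>dickson\<close> one of these leading monomials divides a later one;
  cancelling the later leading term with a multiple of the earlier element leaves a new element at
  the same jump with a smaller leading monomial.\<close>

lemma noetherian_mpoly: "noetherian TYPE(('x::finite \<Rightarrow>\<^sub>0 nat) \<Rightarrow>\<^sub>0 'k::field)"
  unfolding noetherian_def
proof (intro allI impI, rule ccontr)
  fix \<A> :: "(('x \<Rightarrow>\<^sub>0 nat) \<Rightarrow>\<^sub>0 'k) set set"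
  assume ne: "\<A> \<noteq> {}" and ideals: "\<forall>I\<in>\<A>. is_ideal I"
    and "\<not> (\<exists>I\<in>\<A>. \<forall>I'\<in>\<A>. I \<subseteq> I' \<longrightarrow> I' = I)"
  then have "\<forall>I\<in>\<A>. \<exists>I'\<in>\<A>. I \<subset> I'" by blast
  then obtain nxt where nxt: "\<And>I. I \<in> \<A> \<Longrightarrow> nxt I \<in> \<A> \<and> I \<subset> nxt I" by metis
  obtain I0 where I0: "I0 \<in> \<A>" using ne by blast
  define A where "A i = (nxt ^^ i) I0" for i
  have A: "A i \<in> \<A>" for i by (induction i) (auto simp: A_def I0 nxt)
  have A_Suc: "A i \<subset> A (Suc i)" for i using nxt[OF A] by (simp add: A_def)
  then have A_mono: "A i \<subseteq> A j" if "i \<le> j" for i j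
    using that by (simp add: lift_Suc_mono_le psubset_imp_subset)
  have "\<exists>g. g \<in> A (Suc i) - A i \<and> (\<forall>h. wt (lead_expo h) < wt (lead_expo g) \<longrightarrow> h \<notin> A (Suc i) - A i)" for i
  proof -
    have "wf (inv_image {(m, n :: 'x \<Rightarrow>\<^sub>0 nat). wt m < wt n} lead_expo)"
      by (rule wf_inv_image[OF wf_wt])
    moreover obtain g0 where "g0 \<in> A (Suc i) - A i" using A_Suc by blast
    ultimately show ?thesis by (rule wfE_min) (auto simp: inv_image_def)
  qed
  then obtain g where g: "\<And>i. g i \<in> A (Suc i) - A i"
    and min: "\<And>i h. wt (lead_expo h) < wt (lead_expo (g i)) \<Longrightarrow> h \<notin> A (Suc i) - A i" by metis
  obtain i j d where ij: "i < j" "lead_expo (g j) = lead_expo (g i) + d"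
    using dickson[of "\<lambda>i. lead_expo (g i)"] by blast
  have "0 \<in> A i" for i using ideals A is_idealD(1) by blast
  then have g0: "g i \<noteq> 0" for i using g[of i] by (metis DiffD2)
  define c where "c = lookup (g j) (lead_expo (g j)) / lookup (g i) (lead_expo (g i))"
  define h where "h = g j - single d c * g i"
  have "A (Suc i) \<subseteq> A j" using ij by (intro A_mono) simp
  then have gi: "single d c * g i \<in> A j"
    using g[of i] is_idealD(3) ideals A by blast
  have "h \<in> A (Suc j)"
    unfolding h_def using gi A_mono[of j "Suc j"] g[of j] ideals A
    by (intro is_idealD(6)) auto
  moreover have "h \<notin> A j"
  proof
    assume "h \<in> A j"
    then have "h + single d c * g i \<in> A j" using gi ideals A is_idealD(2) by blast
    then show False using g[of j] by (simp add: h_def)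
  qed
  ultimately have h: "h \<in> A (Suc j) - A j" by blast
  then have "h \<noteq> 0" using \<open>0 \<in> A j\<close> by auto
  have "wt (lead_expo h) \<le> wt (lead_expo (g j))"
  proof -
    have "keys h \<subseteq> keys (g j) \<union> keys (single d c * g i)"
      unfolding h_def by (rule keys_diff)
    then have "lead_expo h \<in> keys (g j) \<union> keys (single d c * g i)"
      using lead_expo(1)[OF \<open>h \<noteq> 0\<close>] by (rule subsetD)
    then consider "lead_expo h \<in> keys (g j)"
      | n where "lead_expo h = d + n" "n \<in> keys (g i)"
      using lookup_single_mult(2)[of d c "g i"] by auto
    then show ?thesis
    proof cases
      case 2
      then show ?thesis using lead_expo(2)[OF g0 2(2)] ij(2) by (simp add: weight_add)
    qed (use lead_expo(2)[OF g0] in blast)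
  qed
  moreover have "lead_expo h \<noteq> lead_expo (g j)"
  proof
    assume eq: "lead_expo h = lead_expo (g j)"
    have "lookup h (lead_expo (g j)) = 0"
      using lead_expo(1)[OF g0, of i] lookup_single_mult(1)[of d c "g i" "lead_expo (g i)"]
      unfolding h_def lookup_minus c_def ij(2) by (simp add: add.commute in_keys_iff)
    then show False using lead_expo(1)[OF \<open>h \<noteq> 0\<close>] eq by (simp add: in_keys_iff)
  qed
  ultimately have "wt (lead_expo h) < wt (lead_expo (g j))" using inj_wt by (metis order.not_eq_order_implies_strict)
  then show False using min h by blast
qed

section \<open>Toric primes and the depth bound\<close>

lemma homogeneous_system_nontrivial:
  fixes T :: "'a \<Rightarrow> 'b \<Rightarrow> 'k::field"
  assumes "finite B" "finite A" "card B < card A"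
  shows "\<exists>c. (\<exists>a\<in>A. c a \<noteq> 0) \<and> (\<forall>b\<in>B. (\<Sum>a\<in>A. c a * T a b) = 0)"
  using assms
proof (induction B arbitrary: A T)
  case empty
  then have "A \<noteq> {}" by auto
  then show ?case by (intro exI[of _ "\<lambda>_. 1"]) auto
next
  case (insert b B)
  show ?case
  proof (cases "\<forall>a\<in>A. T a b = 0")
    case True
    have "card B < card A" using insert by simp
    from insert.IH[OF insert.prems(1) this, of T] obtain c
      where c: "\<exists>a\<in>A. c a \<noteq> 0" "\<forall>b\<in>B. (\<Sum>a\<in>A. c a * T a b) = 0" by blast
    then show ?thesis using True by (intro exI[of _ c]) (auto intro!: sum.neutral)
  next
    case False
    then obtain a0 where a0: "a0 \<in> A" "T a0 b \<noteq> 0" by blast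
    define A' where "A' = A - {a0}"
    have A': "finite A'" "a0 \<notin> A'" "A = insert a0 A'" using insert.prems(1) a0(1) by (auto simp: A'_def)
    have "card B < card A'" using insert A' by simp
    \<comment> \<open>Equation \<open>b\<close> is solved for the unknown at \<open>a0\<close> and
      substituted into the remaining equations.\<close>
    from insert.IH[OF A'(1) this, of "\<lambda>a b'. T a b' - T a b / T a0 b * T a0 b'"] obtain c
      where c: "\<exists>a\<in>A'. c a \<noteq> 0"
        "\<And>b'. b' \<in> B \<Longrightarrow> (\<Sum>a\<in>A'. c a * (T a b' - T a b / T a0 b * T a0 b')) = 0" by blast
    define s where "s = (\<Sum>a\<in>A'. c a * T a b)"
    define c' where "c' = c(a0 := - s / T a0 b)"
    have c': "(\<Sum>a\<in>A. c' a * T a b') = - s / T a0 b * T a0 b' + (\<Sum>a\<in>A'. c a * T a b')" for b'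
    proof -
      have "(\<Sum>a\<in>A'. c' a * T a b') = (\<Sum>a\<in>A'. c a * T a b')"
        by (rule sum.cong) (use A'(2) in \<open>auto simp: c'_def\<close>)
      then show ?thesis using A' by (simp add: c'_def)
    qed
    have "(\<Sum>a\<in>A. c' a * T a b') = 0" if "b' \<in> insert b B" for b'
    proof (cases "b' = b")
      case True
      then show ?thesis using c'[of b] a0(2) by (simp add: s_def)
    next
      case False
      have "0 = (\<Sum>a\<in>A'. c a * T a b' - c a * T a b * (T a0 b' / T a0 b))"
        using c(2)[of b'] that False by (simp add: algebra_simps)
      also have "\<dots> = (\<Sum>a\<in>A'. c a * T a b') - s * (T a0 b' / T a0 b)"
        unfolding s_def by (simp only: sum_subtractf sum_distrib_right)
      finally show ?thesis using c'[of b'] by simp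
    qed
    moreover have "\<exists>a\<in>A. c' a \<noteq> 0" using c(1) A'(2,3) by (auto simp: c'_def)
    ultimately show ?thesis by blast
  qed
qed

text \<open>The algebra homomorphism that kills the variables outside \<open>Y\<close> and sends
  each \<open>x\<close> in \<open>Y\<close> to the product of the parameters labelled by
  \<open>S x\<close>. The target is the group algebra of \<open>int poly\<close>, in which a
  monomial in the parameters is represented by its weight.\<close>

definition monomial_hom ::
  "('x::finite \<Rightarrow> 'x set) \<Rightarrow> 'x set \<Rightarrow> (('x \<Rightarrow>\<^sub>0 nat) \<Rightarrow>\<^sub>0 'k::field) \<Rightarrow> (int poly \<Rightarrow>\<^sub>0 'k)" where
  "monomial_hom S Y p =
    (\<Sum>m\<in>keys p. if keys m \<subseteq> Y then single (weight S m) (lookup p m) else 0)"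

lemma lookup_monomial_hom:
  "lookup (monomial_hom S Y p) e =
    (\<Sum>m | m \<in> keys p \<and> keys m \<subseteq> Y \<and> weight S m = e. lookup p m)"
proof -
  have "lookup (monomial_hom S Y p) e =
    (\<Sum>m\<in>keys p. if keys m \<subseteq> Y \<and> weight S m = e then lookup p m else 0)"
    unfolding monomial_hom_def lookup_sum by (rule sum.cong) (auto simp: lookup_single when_def)
  then show ?thesis by (simp add: sum.inter_filter)
qed

lemma monomial_hom_0 [simp]: "monomial_hom S Y 0 = 0"
  unfolding monomial_hom_def by simp

lemma monomial_hom_single:
  "monomial_hom S Y (single m c) = (if keys m \<subseteq> Y then single (weight S m) c else 0)"
  unfolding monomial_hom_def by (cases "c = 0") auto

lemma monomial_hom_add: "monomial_hom S Y (p + q) = monomial_hom S Y p + monomial_hom S Y q"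
proof -
  let ?f = "\<lambda>m c. if keys m \<subseteq> Y then single (weight S m) c else 0"
  show ?thesis unfolding monomial_hom_def
    by (rule setsum_keys_plus_distrib[of ?f]) (auto simp: single_add)
qed

lemma monomial_hom_sum: "monomial_hom S Y (sum g A) = (\<Sum>a\<in>A. monomial_hom S Y (g a))"
  by (induction A rule: infinite_finite_induct) (simp_all add: monomial_hom_add)

lemma sum_single_keys: "(\<Sum>m\<in>keys p. single m (lookup p m)) = p"
proof (rule poly_mapping_eqI)
  fix k
  have "lookup (\<Sum>m\<in>keys p. single m (lookup p m)) k = (\<Sum>m\<in>keys p. if m = k then lookup p m else 0)"
    unfolding lookup_sum by (rule sum.cong) (auto simp: lookup_single when_def)
  then show "lookup (\<Sum>m\<in>keys p. single m (lookup p m)) k = lookup p k"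
    by (simp add: in_keys_iff)
qed

lemma keys_add_nat: "keys (m + n :: 'x \<Rightarrow>\<^sub>0 nat) = keys m \<union> keys n"
  by (auto simp: in_keys_iff lookup_add)

lemma monomial_hom_mult: "monomial_hom S Y (p * q) = monomial_hom S Y p * monomial_hom S Y q"
proof -
  have single: "monomial_hom S Y (single m a * single n b) =
      monomial_hom S Y (single m a) * monomial_hom S Y (single n b)" for m n a b
    by (simp add: mult_single monomial_hom_single keys_add_nat weight_add)
  have "monomial_hom S Y ((\<Sum>m\<in>keys p. single m (lookup p m)) * (\<Sum>n\<in>keys q. single n (lookup q n)))
    = monomial_hom S Y (\<Sum>m\<in>keys p. single m (lookup p m)) *
      monomial_hom S Y (\<Sum>n\<in>keys q. single n (lookup q n))"
    by (simp only: sum_product monomial_hom_sum single)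
  then show ?thesis by (simp only: sum_single_keys)
qed

lemma monomial_hom_1 [simp]: "monomial_hom S Y 1 = 1"
  using monomial_hom_single[of S Y 0 1] by simp

lemma monomial_hom_diff: "monomial_hom S Y (p - q) = monomial_hom S Y p - monomial_hom S Y q"
  using monomial_hom_add[of S Y "p - q" q] by simp

definition toric_prime ::
  "('x::finite \<Rightarrow> 'x set) \<Rightarrow> 'x set \<Rightarrow> (('x \<Rightarrow>\<^sub>0 nat) \<Rightarrow>\<^sub>0 'k::field) set" where
  "toric_prime S Y = {p. monomial_hom S Y p = 0}"

lemma is_prime_toric_prime: "is_prime_ideal (toric_prime S Y)"
proof -
  have "(1 :: ('a \<Rightarrow>\<^sub>0 nat) \<Rightarrow>\<^sub>0 'b) \<notin> toric_prime S Y" by (simp add: toric_prime_def)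
  then have "toric_prime S Y \<noteq> (UNIV :: (('a \<Rightarrow>\<^sub>0 nat) \<Rightarrow>\<^sub>0 'b) set)" by blast
  then show ?thesis
    unfolding is_prime_ideal_def is_ideal_def
    by (simp; auto simp: toric_prime_def monomial_hom_add monomial_hom_mult)
qed

definition origin_ideal :: "(('x \<Rightarrow>\<^sub>0 nat) \<Rightarrow>\<^sub>0 'k::field) set" where
  "origin_ideal = {p. lookup p 0 = 0}"

text \<open>Killing every variable leaves the constant term, so the ideal of the origin is itself
  toric and inherits primality; it also ends the chains of toric primes below.\<close>

lemma origin_ideal_eq:
  fixes S :: "'x::finite \<Rightarrow> 'x set"
  shows "(origin_ideal :: (('x \<Rightarrow>\<^sub>0 nat) \<Rightarrow>\<^sub>0 'k::field) set) = toric_prime S {}"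
proof -
  have "monomial_hom S {} p = single 0 (lookup p 0)" for p :: "('x \<Rightarrow>\<^sub>0 nat) \<Rightarrow>\<^sub>0 'k"
  proof -
    have "monomial_hom S {} p = (\<Sum>m\<in>keys p. if m = 0 then single 0 (lookup p 0) else 0)"
      unfolding monomial_hom_def by (rule sum.cong) auto
    also have "\<dots> = single 0 (lookup p 0)" by (auto simp: in_keys_iff)
    finally show ?thesis .
  qed
  then show ?thesis unfolding origin_ideal_def toric_prime_def
    by (metis (no_types, lifting) lookup_single_eq lookup_zero single_zero)
qed

lemma is_prime_origin_ideal: "is_prime_ideal (origin_ideal :: (('x::finite \<Rightarrow>\<^sub>0 nat) \<Rightarrow>\<^sub>0 'k::field) set)"
  unfolding origin_ideal_eq[of "\<lambda>_. {}"] by (rule is_prime_toric_prime)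

lemma is_maximal_origin_ideal:
  "is_maximal_ideal (origin_ideal :: (('x::finite \<Rightarrow>\<^sub>0 nat) \<Rightarrow>\<^sub>0 'k::field) set)"
  unfolding is_maximal_ideal_def
proof (intro conjI allI impI)
  let ?M = "origin_ideal :: (('x \<Rightarrow>\<^sub>0 nat) \<Rightarrow>\<^sub>0 'k) set"
  show M: "is_ideal ?M" "?M \<noteq> UNIV" using is_prime_origin_ideal by (auto simp: is_prime_ideal_def)
  fix I :: "(('x \<Rightarrow>\<^sub>0 nat) \<Rightarrow>\<^sub>0 'k) set" assume "is_ideal I \<and> ?M \<subseteq> I"
  then have I: "is_ideal I" "?M \<subseteq> I" by auto
  show "I = ?M \<or> I = UNIV"
  proof (cases "I \<subseteq> ?M")
    case False
    then obtain p where p: "p \<in> I" "lookup p 0 \<noteq> 0" unfolding origin_ideal_def by blast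
    define q where "q = single 0 (lookup p 0) - p"
    have "q \<in> ?M" by (simp add: origin_ideal_def q_def lookup_minus)
    then have "single 0 (lookup p 0) \<in> I"
      using is_idealD(2)[OF I(1) _ p(1), of q] I(2) by (auto simp: q_def)
    then have "single 0 (inverse (lookup p 0)) * single 0 (lookup p 0) \<in> I"
      by (rule is_idealD(3)[OF I(1)])
    then have "1 \<in> I" using p(2) by (simp add: mult_single)
    then have "x \<in> I" for x using is_idealD(3)[OF I(1), of 1 x] by simp
    then show ?thesis by blast
  qed (use I in blast)
qed

section \<open>Degrees and the number of weights\<close>

definition total_deg :: "('x::finite \<Rightarrow>\<^sub>0 nat) \<Rightarrow> nat" where
  "total_deg m = (\<Sum>x\<in>UNIV. lookup m x)"

definition deg_le :: "nat \<Rightarrow> (('x::finite \<Rightarrow>\<^sub>0 nat) \<Rightarrow>\<^sub>0 'k::zero) \<Rightarrow> bool" where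
  "deg_le N p \<longleftrightarrow> (\<forall>m\<in>keys p. total_deg m \<le> N)"

lemma deg_le_1: "deg_le 0 (1 :: ('x::finite \<Rightarrow>\<^sub>0 nat) \<Rightarrow>\<^sub>0 'k::field)"
  unfolding deg_le_def total_deg_def by simp

lemma deg_le_mult:
  fixes p q :: "('x::finite \<Rightarrow>\<^sub>0 nat) \<Rightarrow>\<^sub>0 'k::field"
  assumes "deg_le N p" "deg_le N' q" shows "deg_le (N + N') (p * q)"
  unfolding deg_le_def
proof
  fix m assume "m \<in> keys (p * q)"
  then obtain a b where "m = a + b" "a \<in> keys p" "b \<in> keys q" using keys_mult[of p q] by blast
  then show "total_deg m \<le> N + N'"
    using assms unfolding deg_le_def by (auto simp: total_deg_def lookup_add sum.distrib add_mono)
qed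

lemma deg_le_power:
  fixes p :: "('x::finite \<Rightarrow>\<^sub>0 nat) \<Rightarrow>\<^sub>0 'k::field"
  shows "deg_le N p \<Longrightarrow> deg_le (n * N) (p ^ n)"
  by (induction n) (auto simp: deg_le_1 intro: deg_le_mult)

lemma deg_le_prod:
  fixes g :: "'i \<Rightarrow> ('x::finite \<Rightarrow>\<^sub>0 nat) \<Rightarrow>\<^sub>0 'k::field"
  shows "(\<And>a. a \<in> A \<Longrightarrow> deg_le (N a) (g a)) \<Longrightarrow> deg_le (sum N A) (prod g A)"
  by (induction A rule: infinite_finite_induct) (auto simp: deg_le_1 intro!: deg_le_mult)

lemma deg_le_mono: "deg_le N p \<Longrightarrow> N \<le> N' \<Longrightarrow> deg_le N' p"
  unfolding deg_le_def by fastforce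

lemma ex_deg_le:
  fixes f :: "nat \<Rightarrow> ('x::finite \<Rightarrow>\<^sub>0 nat) \<Rightarrow>\<^sub>0 'k::zero"
  shows "\<exists>N. \<forall>i<r. deg_le N (f i)"
proof -
  define K where "K = (\<Union>i<r. keys (f i))"
  have "finite K" by (simp add: K_def)
  then have "\<forall>m\<in>K. total_deg m \<le> Max (total_deg ` K)" by simp
  then show ?thesis unfolding deg_le_def K_def by blast
qed

text \<open>Since \<open>S x\<close> is a set, each occurrence of a variable contributes at most
  once to the label \<open>j\<close>.\<close>

lemma expo_le_total_deg: "expo S m j \<le> total_deg m"
  unfolding expo_def total_deg_def by (rule sum_mono2) auto

lemma expo_outside:
  assumes "keys m \<subseteq> Y" "\<And>x. x \<in> Y \<Longrightarrow> S x \<subseteq> T" "j \<notin> T"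
  shows "expo S m j = 0"
  unfolding expo_def
proof (intro sum.neutral ballI)
  fix x assume "x \<in> {x. j \<in> S x}"
  then have "x \<notin> keys m" using assms by blast
  then show "lookup m x = 0" by (simp add: in_keys_iff)
qed

text \<open>A weight is determined by its exponents at the labels in \<open>T\<close>, and each of
  them is at most \<open>N\<close>. This plays the role of an upper bound for the Hilbert function
  of the quotient by the toric prime.\<close>

lemma card_weights_le:
  fixes S :: "'x::finite \<Rightarrow> 'x set"
  assumes "\<And>x. x \<in> Y \<Longrightarrow> S x \<subseteq> T"
  shows "finite (weight S ` {m. keys m \<subseteq> Y \<and> total_deg m \<le> N})"
    and "card (weight S ` {m. keys m \<subseteq> Y \<and> total_deg m \<le> N}) \<le> (N + 1) ^ card T"
proof -
  let ?D = "{m. keys m \<subseteq> Y \<and> total_deg m \<le> N}"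
  let ?F = "\<lambda>g :: 'x \<Rightarrow> nat. \<Sum>j\<in>UNIV. monom (int (if j \<in> T then g j else 0)) (index j)"
  let ?E = "PiE T (\<lambda>_. {..N})"
  have "weight S m \<in> ?F ` ?E" if m: "m \<in> ?D" for m
  proof
    let ?g = "restrict (expo S m) T"
    show "?g \<in> ?E" using m expo_le_total_deg[of S m] by (auto intro: order_trans)
    show "weight S m = ?F ?g" unfolding weight_def
      by (rule sum.cong) (use m expo_outside[of m Y S T] assms in auto)
  qed
  then have sub: "weight S ` ?D \<subseteq> ?F ` ?E" by blast
  have fin: "finite ?E" by (intro finite_PiE) auto
  then show "finite (weight S ` ?D)" using sub finite_subset by blast
  have "card (weight S ` ?D) \<le> card (?F ` ?E)" using sub fin by (intro card_mono) auto
  also have "\<dots> \<le> card ?E" by (rule card_image_le[OF fin])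
  also have "\<dots> = (N + 1) ^ card T" by (simp add: card_PiE)
  finally show "card (weight S ` ?D) \<le> (N + 1) ^ card T" .
qed

text \<open>No variable of \<open>Y\<close> maps to a constant, so \<open>0\<close> is the only
  exponent of weight \<open>0\<close>; the constant term of the image is that of the
  polynomial.\<close>

lemma toric_prime_le_origin_ideal:
  assumes "\<And>x. x \<in> Y \<Longrightarrow> S x \<noteq> {}"
  shows "toric_prime S Y \<subseteq> origin_ideal"
proof
  fix p :: "('a \<Rightarrow>\<^sub>0 nat) \<Rightarrow>\<^sub>0 'b" assume p: "p \<in> toric_prime S Y"
  have eq: "m = 0" if m: "keys m \<subseteq> Y" "weight S m = 0" for m
  proof -
    have "weight S m = weight S 0" using m by simp
    then have "expo S m j = 0" for j unfolding weight_eq_iff by (simp add: expo_def)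
    then have "lookup m x = 0" if "j \<in> S x" for x j using that unfolding expo_def by auto
    then have "x \<notin> keys m" for x using m(1) assms[of x] by (auto simp: in_keys_iff subset_iff)
    then have "keys m = {}" by blast
    then show ?thesis by simp
  qed
  have "0 = lookup (monomial_hom S Y p) 0" using p by (simp add: toric_prime_def)
  also have "\<dots> = sum (lookup p) {m. m \<in> keys p \<and> keys m \<subseteq> Y \<and> weight S m = 0}"
    by (simp add: lookup_monomial_hom)
  also have "{m. m \<in> keys p \<and> keys m \<subseteq> Y \<and> weight S m = 0} = (if 0 \<in> keys p then {0} else {})"
    using eq by auto
  finally show "p \<in> origin_ideal" by (auto simp: origin_ideal_def in_keys_iff split: if_splits)
qed

text \<open>The elements of a regular sequence are algebraically independent modulo the
associated prime \<open>toric_prime S Y\<close>, whereas the number of monomials of bounded degree in the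
quotient grows only like a power with exponent \<open>card T\<close>.\<close>
lemma local_depth_le:
  fixes J :: "(('x::finite \<Rightarrow>\<^sub>0 nat) \<Rightarrow>\<^sub>0 'k::field) set"
  assumes J: "is_ideal J" "J \<subseteq> toric_prime S Y"
    and ass: "\<And>g. g \<in> toric_prime S Y \<Longrightarrow> \<exists>w. w \<notin> toric_prime S Y \<and> w * g \<in> J"
    and S: "\<And>x. x \<in> Y \<Longrightarrow> S x \<noteq> {}" "\<And>x. x \<in> Y \<Longrightarrow> S x \<subseteq> T"
  shows "local_depth J origin_ideal \<le> card T"
  unfolding local_depth_def
proof (rule Sup_least, clarify)
  let ?M = "origin_ideal :: (('x::finite \<Rightarrow>\<^sub>0 nat) \<Rightarrow>\<^sub>0 'k::field) set"
  let ?P = "toric_prime S Y :: (('x::finite \<Rightarrow>\<^sub>0 nat) \<Rightarrow>\<^sub>0 'k::field) set"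
  fix r and f :: "nat \<Rightarrow> ('x \<Rightarrow>\<^sub>0 nat) \<Rightarrow>\<^sub>0 'k"
  assume reg: "\<forall>i<r. f i \<in> ?M \<and> nzd_local (ideal_span (J \<union> f ` {..<i})) ?M (f i)"
  show "enat r \<le> enat (card T)"
  proof (rule ccontr)
    assume "\<not> enat r \<le> enat (card T)"
    then have r: "Suc (card T) \<le> r" by simp
    obtain D where D: "\<And>i. i < r \<Longrightarrow> deg_le D (f i)" using ex_deg_le by blast
    \<comment> \<open>Each product \<open>mon \<alpha>\<close> has degree at most \<open>N\<close>,
      and \<open>N + 1 \<le> (r * D + 1) * (t + 1)\<close>. This \<open>t\<close> absorbs the
      constant factor: there are at most \<open>t * (t + 1) ^ card T\<close> weights, fewer than the
      \<open>(t + 1) ^ r\<close> products.\<close>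
    define t where "t = (r * D + 1) ^ card T"
    define N where "N = r * D * t"
    let ?A = "PiE {0..<r} (\<lambda>_. {..t})"
    let ?B = "weight S ` {m. keys m \<subseteq> Y \<and> total_deg m \<le> N}"
    define mon where "mon \<alpha> = (\<Prod>j\<in>{0..<r}. f j ^ \<alpha> j)" for \<alpha> :: "nat \<Rightarrow> nat"
    have mon_deg: "deg_le N (mon \<alpha>)" if "\<alpha> \<in> ?A" for \<alpha>
    proof -
      have "deg_le (\<Sum>j\<in>{0..<r}. \<alpha> j * D) (mon \<alpha>)"
        unfolding mon_def by (intro deg_le_prod deg_le_power D) simp
      moreover have "(\<Sum>j\<in>{0..<r}. \<alpha> j * D) \<le> (\<Sum>j\<in>{0..<r}. t * D)"
        using that by (intro sum_mono mult_right_mono) (auto simp: PiE_iff)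
      ultimately show ?thesis by (rule deg_le_mono[OF _ order_trans]) (simp add: N_def)
    qed
    have "card ?B \<le> (N + 1) ^ card T" by (rule card_weights_le(2)[OF S(2)])
    also have "\<dots> \<le> ((r * D + 1) * (t + 1)) ^ card T"
      by (rule power_mono) (auto simp: N_def)
    also have "\<dots> = t * (t + 1) ^ card T" by (simp only: power_mult_distrib t_def)
    also have "\<dots> < (t + 1) ^ Suc (card T)" by simp
    also have "\<dots> \<le> (t + 1) ^ r" by (rule power_increasing[OF r]) simp
    also have "\<dots> = card ?A" by (simp add: card_PiE)
    finally have "card ?B < card ?A" .
    from homogeneous_system_nontrivial[OF card_weights_le(1)[OF S(2)] _ this,
        of "\<lambda>\<alpha> b. lookup (monomial_hom S Y (mon \<alpha>)) b"]
    obtain c where c: "\<exists>\<alpha>\<in>?A. c \<alpha> \<noteq> 0"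
      "\<And>b. b \<in> ?B \<Longrightarrow> (\<Sum>\<alpha>\<in>?A. c \<alpha> * lookup (monomial_hom S Y (mon \<alpha>)) b) = 0"
      by (auto simp: finite_PiE)
    define x where "x = (\<Sum>\<alpha>\<in>?A. single 0 (c \<alpha>) * mon \<alpha>)"
    have x: "nonzero_expr ?M f r 0 x"
      unfolding x_def mon_def by (rule nonzero_expr_sum) (use c(1) in \<open>auto simp: origin_ideal_def\<close>)
    have "lookup (monomial_hom S Y x) b = 0" for b
    proof -
      have "lookup (monomial_hom S Y x) b = (\<Sum>\<alpha>\<in>?A. c \<alpha> * lookup (monomial_hom S Y (mon \<alpha>)) b)"
        by (simp add: lookup_single_mult(1)[of 0, simplified] x_def monomial_hom_sum monomial_hom_mult monomial_hom_single lookup_sum)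
      also have "\<dots> = 0"
      proof (cases "b \<in> ?B")
        case False
        have "lookup (monomial_hom S Y (mon \<alpha>)) b = 0" if "\<alpha> \<in> ?A" for \<alpha>
          unfolding lookup_monomial_hom using False mon_deg[OF that]
          by (intro sum.neutral) (auto simp: deg_le_def)
        then show ?thesis by simp
      qed (rule c(2))
      finally show ?thesis .
    qed
    \<comment> \<open>Hence \<open>x * w\<close> lies in \<open>J\<close> although \<open>x\<close>
      is a nonzero expression in the regular sequence. Torsion-freeness makes \<open>w\<close>
      vanish locally at the origin, which is impossible because \<open>w\<close> is outside the
      prime and the prime lies below the origin.\<close>
    then have "x \<in> ?P" by (auto simp: toric_prime_def intro: poly_mapping_eqI)
    then obtain w where w: "w \<notin> ?P" "w * x \<in> J" using ass by blast
    have span: "ideal_span (J \<union> f ` {..<0}) = J"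
      using ideal_span_superset[of J] ideal_span_minimal[OF J(1), of J] by auto
    have "x * w \<in> saturation ?M (ideal_span (J \<union> f ` {..<0}))"
      unfolding span using w(2) saturation_superset[OF is_prime_origin_ideal] by (auto simp: mult.commute)
    from torsion_free[OF noetherian_mpoly is_prime_origin_ideal reg x this]
    obtain u where u: "u \<notin> ?M" "u * w \<in> J" unfolding span saturation_def by blast
    have "u \<notin> ?P" using u(1) toric_prime_le_origin_ideal[of Y S] S(1) by blast
    then have "u * w \<notin> ?P" using w(1) prime_not_in_mult[OF is_prime_toric_prime] by blast
    then show False using u(2) J(2) by blast
  qed
qed

section \<open>Rank-one blocks and binomial edge ideals\<close>

lemma expo_single: "expo S (single x n) j = (if j \<in> S x then n else 0)"
proof -
  have "expo S (single x n) j = (\<Sum>y | j \<in> S y. if y = x then n else 0)"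
    unfolding expo_def by (rule sum.cong) (auto simp: lookup_single when_def)
  then show ?thesis by simp
qed

lemma Var_notin_toric_prime:
  "(Var x :: ('n::finite, 'k::field) bpoly) \<notin> toric_prime S Y \<longleftrightarrow> x \<in> Y"
  by (auto simp: toric_prime_def Var_def monomial_hom_single dest: arg_cong[where f = keys])

text \<open>Each dropped variable carries a label that no remaining variable has. A monomial in
  \<open>Y\<close> with the same image as a monomial in \<open>Y'\<close> therefore avoids the
  dropped variables, so a sum over a fibre that vanished for \<open>Y\<close> still vanishes for
  \<open>Y'\<close>.\<close>

lemma toric_prime_psubset:
  fixes S :: "'x::finite \<Rightarrow> 'x set"
  assumes "Y' \<subset> Y" and sep: "\<And>x. x \<in> Y - Y' \<Longrightarrow> \<exists>j\<in>S x. \<forall>y\<in>Y'. j \<notin> S y"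
  shows "(toric_prime S Y :: (('x \<Rightarrow>\<^sub>0 nat) \<Rightarrow>\<^sub>0 'k::field) set) \<subset> toric_prime S Y'"
proof
  show "(toric_prime S Y :: (('x \<Rightarrow>\<^sub>0 nat) \<Rightarrow>\<^sub>0 'k) set) \<subseteq> toric_prime S Y'"
  proof
    fix p :: "('x \<Rightarrow>\<^sub>0 nat) \<Rightarrow>\<^sub>0 'k" assume p: "p \<in> toric_prime S Y"
    have same: "keys n \<subseteq> Y'" if mn: "keys m \<subseteq> Y'" "keys n \<subseteq> Y" "weight S n = weight S m" for m n
    proof (rule ccontr)
      assume "\<not> keys n \<subseteq> Y'"
      then obtain x where x: "x \<in> keys n" "x \<in> Y - Y'" using mn(2) by blast
      then obtain j where j: "j \<in> S x" "\<forall>y\<in>Y'. j \<notin> S y" using sep by blast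
      have "expo S m j = 0" unfolding expo_def
      proof (intro sum.neutral ballI)
        fix y assume "y \<in> {y. j \<in> S y}"
        then have "y \<notin> keys m" using j(2) mn(1) by blast
        then show "lookup m y = 0" by (simp add: in_keys_iff)
      qed
      moreover have "lookup n x \<le> expo S n j"
        unfolding expo_def using j(1) by (intro member_le_sum) auto
      ultimately show False using x(1) mn(3) by (auto simp: weight_eq_iff in_keys_iff)
    qed
    have "lookup (monomial_hom S Y' p) e = 0" for e
    proof (cases "\<exists>m. m \<in> keys p \<and> keys m \<subseteq> Y' \<and> weight S m = e")
      case True
      then obtain m where m: "keys m \<subseteq> Y'" "weight S m = e" by blast
      have "keys n \<subseteq> Y' \<longleftrightarrow> keys n \<subseteq> Y" if "weight S n = e" for n
        using same[OF m(1), of n] that m(2) assms(1) by auto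
      then have "{m. m \<in> keys p \<and> keys m \<subseteq> Y' \<and> weight S m = e} =
          {m. m \<in> keys p \<and> keys m \<subseteq> Y \<and> weight S m = e}"
        by auto
      then have "lookup (monomial_hom S Y' p) e = lookup (monomial_hom S Y p) e"
        by (simp add: lookup_monomial_hom)
      then show ?thesis using p by (simp add: toric_prime_def)
    next
      case False
      then show ?thesis unfolding lookup_monomial_hom by (intro sum.neutral) blast
    qed
    then show "p \<in> toric_prime S Y'" by (auto simp: toric_prime_def intro: poly_mapping_eqI)
  qed
  obtain x where x: "x \<in> Y" "x \<notin> Y'" using assms(1) by blast
  have "single (single x 1) (1 :: 'k) \<in> toric_prime S Y'" "single (single x 1) (1 :: 'k) \<notin> toric_prime S Y"
    using x by (auto simp: toric_prime_def monomial_hom_single dest: arg_cong[where f = keys])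
  then show "(toric_prime S Y :: (('x \<Rightarrow>\<^sub>0 nat) \<Rightarrow>\<^sub>0 'k) set) \<noteq> toric_prime S Y'" by blast
qed

section \<open>Chains of primes ending at the origin\<close>

definition prime_chain :: "'a::comm_ring_1 set \<Rightarrow> 'a set \<Rightarrow> nat \<Rightarrow> bool" where
  "prime_chain M P r \<longleftrightarrow> (\<exists>Q :: nat \<Rightarrow> 'a set. Q 0 = P \<and>
     (\<forall>i\<le>r. is_prime_ideal (Q i)) \<and> (\<forall>i<r. Q i \<subset> Q (Suc i)) \<and> Q r \<subseteq> M)"

lemma prime_chain_0: "is_prime_ideal P \<Longrightarrow> P \<subseteq> M \<Longrightarrow> prime_chain M P 0"
  unfolding prime_chain_def by (intro exI[of _ "\<lambda>_. P"]) auto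

lemma prime_chain_Suc:
  assumes "prime_chain M P' r" "is_prime_ideal P" "P \<subset> P'"
  shows "prime_chain M P (Suc r)"
proof -
  obtain Q where Q: "Q 0 = P'" "\<forall>i\<le>r. is_prime_ideal (Q i)" "\<forall>i<r. Q i \<subset> Q (Suc i)" "Q r \<subseteq> M"
    using assms(1) unfolding prime_chain_def by blast
  show ?thesis unfolding prime_chain_def
    by (rule exI[of _ "case_nat P Q"]) (use Q assms in \<open>auto split: nat.split\<close>)
qed

lemma prime_chain_le_local_dim: "prime_chain M P r \<Longrightarrow> J \<subseteq> P \<Longrightarrow> enat r \<le> local_dim J M"
  unfolding prime_chain_def local_dim_def by (intro Sup_upper) blast

text \<open>The monomial parametrization of the pairs \<open>(a_v, b_v)\<close> forming a matrix of rank at most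
one on the columns in \<open>W\<close> (\<open>a_v = t_v\<close> and \<open>b_v = y t_v\<close>, the parameter \<open>y\<close> being
labelled by \<open>(False, p)\<close>) and arbitrary on the other columns.\<close>
definition block_map :: "'n \<Rightarrow> 'n set \<Rightarrow> bool \<times> 'n \<Rightarrow> (bool \<times> 'n) set" where
  "block_map p W x = (if snd x \<in> W \<and> \<not> fst x then {(True, snd x), (False, p)} else {x})"

text \<open>Geometrically: the vertices outside \<open>U \<union> W\<close> are deleted, those of
  \<open>U\<close> stand isolated with free columns, and \<open>W\<close> carries a matrix of rank
  at most one.\<close>

abbreviation block_prime :: "'n \<Rightarrow> 'n set \<Rightarrow> 'n set \<Rightarrow> ('n::finite, 'k::field) bpoly set" where
  "block_prime p U W \<equiv> toric_prime (block_map p W) (UNIV \<times> (U \<union> W))"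

lemma prime_chain_coordinates:
  assumes "Y \<subseteq> UNIV \<times> - W \<union> {True} \<times> UNIV"
  shows "prime_chain origin_ideal
    (toric_prime (block_map p W) Y :: ('n::finite, 'k::field) bpoly set) (card Y)"
proof -
  have "finite Y" by simp
  then show ?thesis using assms
  proof (induction Y)
    case empty
    have "(origin_ideal :: ('n, 'k) bpoly set) = toric_prime (block_map p W) {}"
      by (rule origin_ideal_eq)
    then show ?case using prime_chain_0[OF is_prime_origin_ideal[where 'x = "bool \<times> 'n" and 'k = 'k]] by simp
  next
    case (insert x Y)
    have S: "block_map p W y = {y}" if "y \<in> insert x Y" for y
      using insert.prems that by (auto simp: block_map_def)
    have "(toric_prime (block_map p W) (insert x Y) :: ('n, 'k) bpoly set)
      \<subset> toric_prime (block_map p W) Y"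
      using insert.hyps by (intro toric_prime_psubset) (auto simp: S)
    from prime_chain_Suc[OF _ is_prime_toric_prime this] insert show ?case by simp
  qed
qed

text \<open>The columns of \<open>W\<close> other than \<open>p\<close> are killed one at a time
  (\<open>card W - 1\<close> steps), next \<open>b_p\<close> (one step), and finally the remaining
  \<open>2 * card U + 1\<close> coordinates.\<close>

lemma prime_chain_block:
  assumes p: "p \<in> W" and UW: "U \<inter> W = {}"
  shows "prime_chain origin_ideal
    (block_prime p U W :: ('n::finite, 'k::field) bpoly set) (2 * card U + card W + 1)"
proof -
  let ?S = "block_map p W"
  let ?Y = "\<lambda>W'. (UNIV :: bool set) \<times> (U \<union> W')"
  have "prime_chain origin_ideal (toric_prime ?S (?Y (insert p V)) :: ('n, 'k) bpoly set)
      (2 * card U + card V + 2)" if "finite V" "V \<subseteq> W - {p}" for V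
    using that
  proof (induction V)
    case empty
    \<comment> \<open>Column \<open>p\<close> has to go last: the parameter
      \<open>(False, p)\<close> occurs in every \<open>b_v\<close> with \<open>v\<close> in
      \<open>W\<close>, so it separates \<open>b_p\<close> only once the other columns are
      gone.\<close>
    let ?Y' = "UNIV \<times> U \<union> {(True, p)}"
    have less: "(toric_prime ?S (?Y {p}) :: ('n, 'k) bpoly set) \<subset> toric_prime ?S ?Y'"
    proof (rule toric_prime_psubset)
      show "?Y' \<subset> ?Y {p}" using p UW by auto
      fix x assume "x \<in> ?Y {p} - ?Y'"
      then have "x = (False, p)" by auto
      then show "\<exists>j\<in>?S x. \<forall>y\<in>?Y'. j \<notin> ?S y"
        using p UW by (intro bexI[of _ "(False, p)"]) (auto simp: block_map_def)
    qed
    have card: "card ?Y' = 2 * card U + 1"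
    proof -
      have "(True, p) \<notin> UNIV \<times> U" using p UW by auto
      then show ?thesis by (simp add: card_cartesian_product)
    qed
    have chain: "prime_chain origin_ideal (toric_prime ?S ?Y' :: ('n, 'k) bpoly set) (card ?Y')"
      using UW by (intro prime_chain_coordinates) auto
    show ?case using prime_chain_Suc[OF chain is_prime_toric_prime less] card by simp
  next
    case (insert v V)
    have "(toric_prime ?S (?Y (insert p (insert v V))) :: ('n, 'k) bpoly set)
      \<subset> toric_prime ?S (?Y (insert p V))"
    proof (rule toric_prime_psubset)
      show "?Y (insert p V) \<subset> ?Y (insert p (insert v V))" using insert UW by auto
      fix x assume "x \<in> ?Y (insert p (insert v V)) - ?Y (insert p V)"
      then obtain b where x: "x = (b, v)" "v \<notin> U \<union> insert p V" by auto
      show "\<exists>j\<in>?S x. \<forall>y\<in>?Y (insert p V). j \<notin> ?S y"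
        using x insert.prems
        by (intro bexI[of _ "(True, v)"]) (auto simp: block_map_def)
    qed
    from prime_chain_Suc[OF _ is_prime_toric_prime this] insert show ?case by simp
  qed
  from this[of "W - {p}"] have "prime_chain origin_ideal (block_prime p U W :: ('n, 'k) bpoly set)
      (2 * card U + card (W - {p}) + 2)" using p by (simp add: insert_absorb)
  moreover have "card W = Suc (card (W - {p}))" by (rule card.remove[OF finite p])
  ultimately show ?thesis by simp
qed

section \<open>Edge binomials and block primes\<close>

definition minor :: "'n \<Rightarrow> 'n \<Rightarrow> ('n, 'k::field) bpoly" where
  "minor i j = Var (True, i) * Var (False, j) - Var (True, j) * Var (False, i)"

lemma minor_in_binomial_edge_ideal: "E i j \<Longrightarrow> minor i j \<in> binomial_edge_ideal E"
  unfolding binomial_edge_ideal_def minor_def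
  by (rule subsetD[OF ideal_span_superset]) blast

lemma Var_mult: "(Var x * Var y :: ('n, 'k::field) bpoly) = single (single x 1 + single y 1) 1"
  unfolding Var_def by (simp add: mult_single)

lemma minor_in_toric_prime_iff:
  assumes "i \<in> A" "j \<in> A"
  shows "(minor i j :: ('n::finite, 'k::field) bpoly) \<in> toric_prime S (UNIV \<times> A) \<longleftrightarrow>
    weight S (single (True, i) 1 + single (False, j) 1) = weight S (single (True, j) 1 + single (False, i) 1)"
proof -
  have "single e (1 :: 'k) - single e' 1 = 0 \<longleftrightarrow> e = e'" for e e' :: "int poly"
    by (auto dest: arg_cong[where f = keys])
  then show ?thesis
    using assms by (simp add: minor_def toric_prime_def Var_mult monomial_hom_diff
        monomial_hom_single keys_add_nat)
qed

lemma minor_in_block_prime: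
  assumes "i \<notin> U \<union> W \<or> j \<notin> U \<union> W \<or> (i \<in> W \<and> j \<in> W)"
  shows "(minor i j :: ('n::finite, 'k::field) bpoly) \<in> block_prime p U W"
proof (cases "i \<in> W \<and> j \<in> W")
  case True
  then have "expo (block_map p W) (single (True, i) 1 + single (False, j) 1) =
    expo (block_map p W) (single (True, j) 1 + single (False, i) 1)"
    by (auto simp: fun_eq_iff expo_add expo_single block_map_def)
  then show ?thesis using True by (subst minor_in_toric_prime_iff) (auto simp: weight_eq_iff)
next
  case False
  then show ?thesis using assms
    by (auto simp: minor_def toric_prime_def Var_mult monomial_hom_diff monomial_hom_single keys_add_nat)
qed

lemma minor_notin_block_prime:
  assumes "i \<noteq> j" "i \<in> U \<union> W" "j \<in> U \<union> W" "\<not> (i \<in> W \<and> j \<in> W)"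
  shows "(minor i j :: ('n::finite, 'k::field) bpoly) \<notin> block_prime p U W"
proof
  assume "(minor i j :: ('n, 'k) bpoly) \<in> block_prime p U W"
  then have eq: "expo (block_map p W) (single (True, i) 1 + single (False, j) 1) x =
    expo (block_map p W) (single (True, j) 1 + single (False, i) 1) x" for x
    using assms by (simp add: minor_in_toric_prime_iff weight_eq_iff)
  show False
  \<comment> \<open>The label of the \<open>a\<close>-variable at an index outside \<open>W\<close>
    occurs in only one of the two monomials.\<close>
  proof (cases "i \<in> W")
    case False
    then show False using eq[of "(True, i)"] assms
      by (auto simp: expo_add expo_single block_map_def split: if_splits)
  next
    case True
    then show False using eq[of "(True, j)"] assms
      by (auto simp: expo_add expo_single block_map_def split: if_splits)
  qed
qed

lemma binomial_edge_ideal_le_block_prime: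
  assumes "\<And>i j. E i j \<Longrightarrow> i \<notin> U \<union> W \<or> j \<notin> U \<union> W \<or> (i \<in> W \<and> j \<in> W)"
  shows "(binomial_edge_ideal E :: ('n::finite, 'k::field) bpoly set) \<subseteq> block_prime p U W"
  unfolding binomial_edge_ideal_def
proof (rule ideal_span_minimal)
  show "is_ideal (block_prime p U W :: ('n, 'k) bpoly set)"
    using is_prime_toric_prime by (auto simp: is_prime_ideal_def)
next
  show "{Var (True, i) * Var (False, j) - Var (True, j) * Var (False, i) | i j. E i j}
    \<subseteq> (block_prime p U W :: ('n, 'k) bpoly set)"
    using minor_in_block_prime[where 'k = 'k, OF assms, unfolded minor_def] by blast
qed

text \<open>Any prime over the ideal bounds the dimension from below, minimal or not, so
  \<open>W\<close> may be a union of several components of the remaining graph.\<close>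

lemma local_dim_ge:
  assumes "p \<in> W" "U \<inter> W = {}"
    and "\<And>i j. E i j \<Longrightarrow> i \<notin> U \<union> W \<or> j \<notin> U \<union> W \<or> (i \<in> W \<and> j \<in> W)"
  shows "enat (2 * card U + card W + 1) \<le>
    local_dim (binomial_edge_ideal E :: ('n::finite, 'k::field) bpoly set) origin_ideal"
  by (intro prime_chain_le_local_dim[OF prime_chain_block[OF assms(1,2)]]
      binomial_edge_ideal_le_block_prime assms(3))

text \<open>The labels are themselves variables, so the image of a monomial can be read as a
  monomial of the original ring. This is the normal form used for rewriting.\<close>

definition expo_mapping :: "('x::finite \<Rightarrow> 'x set) \<Rightarrow> ('x \<Rightarrow>\<^sub>0 nat) \<Rightarrow> 'x \<Rightarrow>\<^sub>0 nat" where
  "expo_mapping S m = Abs_poly_mapping (expo S m)"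

lemma lookup_expo_mapping [simp]: "lookup (expo_mapping S m) = expo S m"
  unfolding expo_mapping_def by (rule lookup_Abs_poly_mapping) simp

lemma expo_mapping_add: "expo_mapping S (m + n) = expo_mapping S m + expo_mapping S n"
  by (rule poly_mapping_eqI) (simp add: expo_add lookup_add)

lemma poly_mapping_nat_induct [case_names zero add]:
  fixes m :: "'x::finite \<Rightarrow>\<^sub>0 nat"
  assumes "P 0" "\<And>m x. P m \<Longrightarrow> P (m + single x 1)"
  shows "P m"
proof (induction "total_deg m" arbitrary: m rule: less_induct)
  case less
  show ?case
  proof (cases "m = 0")
    case False
    then have "keys m \<noteq> {}" by simp
    then obtain x where "x \<in> keys m" by blast
    then have x: "lookup m x \<noteq> 0" by (simp add: in_keys_iff)
    define n where "n = m - single x 1"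
    have m: "m = n + single x 1"
      using x by (auto intro!: poly_mapping_eqI simp: n_def lookup_add lookup_minus lookup_single when_def)
    have "total_deg m = total_deg n + 1"
      unfolding m total_deg_def by (simp add: lookup_add lookup_single sum.distrib when_def)
    then show ?thesis using less assms(2) m by simp
  qed (use assms in simp)
qed

text \<open>Modulo the ideal, multiplication by a power of \<open>a_p\<close> brings each monomial into a normal
form that depends only on its image under the parametrization.\<close>
lemma monomial_normal_form:
  fixes Q :: "('n::finite, 'k::field) bpoly set"
  assumes Q: "is_ideal Q" and W: "\<And>v. v \<in> W - {p} \<Longrightarrow> minor p v \<in> Q" and p: "p \<in> W"
  shows "Var (True, p) ^ expo (block_map p W) m (False, p) * single m 1
    - single (expo_mapping (block_map p W) m) 1 \<in> Q"
proof (induction m rule: poly_mapping_nat_induct)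
  case zero
  have "expo_mapping (block_map p W) 0 = 0"
    by (rule poly_mapping_eqI) (simp add: expo_def)
  moreover have "expo (block_map p W) 0 (False, p) = 0" by (simp add: expo_def)
  ultimately show ?case using is_idealD(1)[OF Q] by simp
next
  case (add m x)
  let ?S = "block_map p W"
  let ?a = "Var (True, p) :: ('n, 'k) bpoly"
  let ?e = "\<lambda>m. expo ?S m (False, p)"
  let ?X = "\<lambda>m. single m 1 :: ('n, 'k) bpoly"
  let ?E = "\<lambda>m. ?X (expo_mapping ?S m)"
  have Em: "expo_mapping ?S (single x 1) = (if snd x \<in> W \<and> \<not> fst x
      then single (True, snd x) 1 + single (False, p) 1 else single x 1)"
    by (rule poly_mapping_eqI) (auto simp: expo_single block_map_def lookup_add lookup_single when_def)
  \<comment> \<open>For \<open>b_v\<close> with \<open>v\<close> in \<open>W\<close> the congruence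
    of \<open>a_p b_v\<close> and \<open>a_v b_p\<close> is exactly \<open>minor p v\<close>, which
    is zero for \<open>v = p\<close>. Every other variable is its own normal form and needs no
    factor \<open>a_p\<close>.\<close>
  have x: "?a ^ ?e (single x 1) * ?X (single x 1) - ?E (single x 1) \<in> Q"
  proof (cases "snd x \<in> W \<and> \<not> fst x")
    case True
    then obtain v where v: "x = (False, v)" "v \<in> W" by (cases x) auto
    then have e: "?e (single x 1) = 1" by (simp add: expo_single block_map_def)
    have "?a ^ ?e (single x 1) * ?X (single x 1) - ?E (single x 1) = minor p v"
      unfolding Em e using v by (simp add: minor_def Var_def mult_single add.commute)
    moreover have "minor p v \<in> Q"
      using W[of v] v(2) is_idealD(1)[OF Q] by (cases "v = p") (auto simp: minor_def)
    ultimately show ?thesis by simp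
  next
    case False
    then have e: "?e (single x 1) = 0" using p by (auto simp: expo_single block_map_def)
    show ?thesis unfolding Em if_not_P[OF False] e using is_idealD(1)[OF Q] by simp
  qed
  have "?a ^ ?e (m + single x 1) * ?X (m + single x 1) - ?E (m + single x 1) =
      (?a ^ ?e m * ?X m) * (?a ^ ?e (single x 1) * ?X (single x 1) - ?E (single x 1))
      + ?E (single x 1) * (?a ^ ?e m * ?X m - ?E m)"
  proof -
    have "?X (m + single x 1) = ?X m * ?X (single x 1)" "?E (m + single x 1) = ?E m * ?E (single x 1)"
      by (simp_all add: mult_single expo_mapping_add)
    then show ?thesis by (simp only: expo_add power_add) (simp add: algebra_simps)
  qed
  also have "\<dots> \<in> Q" by (rule is_idealD(2)[OF Q is_idealD(3)[OF Q x] is_idealD(3)[OF Q add]])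
  finally show ?case .
qed

text \<open>After multiplication by a high enough power of \<open>a_p\<close>, monomials with equal
  image become congruent modulo \<open>Q\<close>. Grouped by image, the coefficients of
  \<open>g\<close> add up to zero in each group, and monomials with a variable outside
  \<open>Y\<close> are in \<open>Q\<close> anyway.\<close>

lemma toric_prime_le_saturated:
  fixes Q :: "('n::finite, 'k::field) bpoly set"
  assumes Q: "is_ideal Q" and W: "\<And>v. v \<in> W - {p} \<Longrightarrow> minor p v \<in> Q" and p: "p \<in> W"
    and dead: "\<And>x. x \<notin> Y \<Longrightarrow> Var x \<in> Q"
    and g: "g \<in> toric_prime (block_map p W) Y"
  shows "\<exists>N. Var (True, p) ^ N * g \<in> Q"
proof -
  let ?S = "block_map p W"
  let ?a = "Var (True, p) :: ('n, 'k) bpoly"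
  let ?e = "\<lambda>m. expo ?S m (False, p)"
  let ?X = "\<lambda>m. single m 1 :: ('n, 'k) bpoly"
  let ?E = "\<lambda>m. ?X (expo_mapping ?S m)"
  define K where "K = {m \<in> keys g. keys m \<subseteq> Y}"
  define N where "N = Max (insert 0 (?e ` K))"
  have fin: "finite K" by (simp add: K_def)
  have N: "?e m \<le> N" if "m \<in> K" for m using that fin by (simp add: N_def)
  have single: "single m c = single 0 c * ?X m" for m and c :: 'k by (simp add: mult_single)
  have outside: "single m c \<in> Q" if "\<not> keys m \<subseteq> Y" for m and c :: 'k
  proof -
    obtain x where x: "x \<in> keys m" "x \<notin> Y" using \<open>\<not> keys m \<subseteq> Y\<close> by blast
    have "m = (m - single x 1) + single x 1"
      using x(1) by (auto intro!: poly_mapping_eqI simp: in_keys_iff lookup_add lookup_minus lookup_single when_def)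
    then have "single m c = single (m - single x 1) c * Var x"
      unfolding Var_def by (simp add: mult_single)
    then show ?thesis using is_idealD(3)[OF Q dead[OF x(2)]] by simp
  qed
  \<comment> \<open>The common normal form of all monomials of weight \<open>w\<close> after
    multiplication by \<open>a_p ^ N\<close>. The exponent of \<open>(False, p)\<close> is read off
    from \<open>w\<close>, and the choice made by \<open>SOME\<close> is harmless because equal
    weights give equal images.\<close>
  define G where "G w = ?a ^ (N - nat (coeff w (index (False, p)))) *
      ?E (SOME m. weight ?S m = w)" for w
  have G: "G (weight ?S m) = ?a ^ (N - ?e m) * ?E m" for m
  proof -
    have "weight ?S (SOME n. weight ?S n = weight ?S m) = weight ?S m" by (rule someI) simp
    then have "expo_mapping ?S (SOME n. weight ?S n = weight ?S m) = expo_mapping ?S m"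
      unfolding weight_eq_iff expo_mapping_def by simp
    then show ?thesis unfolding G_def coeff_weight by simp
  qed
  have normal: "?a ^ N * single m c - single 0 c * G (weight ?S m) \<in> Q" if "m \<in> K" for m and c :: 'k
  proof -
    have "?a ^ N = ?a ^ (N - ?e m) * ?a ^ ?e m" using N[OF that] by (simp add: power_add[symmetric])
    then have "?a ^ N * single m c - single 0 c * G (weight ?S m) =
      (single 0 c * ?a ^ (N - ?e m)) * (?a ^ ?e m * ?X m - ?E m)"
      unfolding G by (subst single) (simp add: algebra_simps)
    then show ?thesis using is_idealD(3)[OF Q monomial_normal_form[OF Q W p]] by simp
  qed
  have "(\<Sum>m\<in>K. single 0 (lookup g m) * G (weight ?S m)) =
    (\<Sum>w\<in>weight ?S ` K. \<Sum>m | m \<in> K \<and> weight ?S m = w. single 0 (lookup g m) * G (weight ?S m))"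
    by (rule sum.image_gen[OF fin])
  also have "\<dots> = 0"
  proof (rule sum.neutral, rule ballI)
    fix w
    have "0 = lookup (monomial_hom ?S Y g) w" using g by (simp add: toric_prime_def)
    also have "\<dots> = (\<Sum>m | m \<in> K \<and> weight ?S m = w. lookup g m)"
      unfolding lookup_monomial_hom K_def by (simp add: conj_assoc)
    finally have 0: "(\<Sum>m | m \<in> K \<and> weight ?S m = w. lookup g m) = 0" by simp
    have "(\<Sum>m | m \<in> K \<and> weight ?S m = w. single 0 (lookup g m) * G (weight ?S m)) =
      (\<Sum>m | m \<in> K \<and> weight ?S m = w. single 0 (lookup g m)) * G w"
      unfolding sum_distrib_right by (rule sum.cong) auto
    also have "(\<Sum>m | m \<in> K \<and> weight ?S m = w. single 0 (lookup g m)) =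
      (single 0 (\<Sum>m | m \<in> K \<and> weight ?S m = w. lookup g m) :: ('n, 'k) bpoly)"
      by (rule poly_mapping_eqI) (simp add: lookup_sum lookup_single when_def)
    finally show "(\<Sum>m | m \<in> K \<and> weight ?S m = w. single 0 (lookup g m) * G (weight ?S m)) = 0"
      by (simp add: 0)
  qed
  finally have zero: "(\<Sum>m\<in>K. single 0 (lookup g m) * G (weight ?S m)) = 0" .
  have "g = (\<Sum>m\<in>keys g. single m (lookup g m))" by (rule sum_single_keys[symmetric])
  also have "keys g = K \<union> (keys g - K)" by (auto simp: K_def)
  also have "(\<Sum>m\<in>K \<union> (keys g - K). single m (lookup g m)) =
      (\<Sum>m\<in>K. single m (lookup g m)) + (\<Sum>m\<in>keys g - K. single m (lookup g m))"
    by (rule sum.union_disjoint) (auto simp: fin)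
  finally have "?a ^ N * g = ?a ^ N * ((\<Sum>m\<in>K. single m (lookup g m)) + (\<Sum>m\<in>keys g - K. single m (lookup g m)))"
    by (rule arg_cong)
  also have "\<dots> = ((\<Sum>m\<in>K. ?a ^ N * single m (lookup g m)) -
      (\<Sum>m\<in>K. single 0 (lookup g m) * G (weight ?S m))) + ?a ^ N * (\<Sum>m\<in>keys g - K. single m (lookup g m))"
    unfolding zero by (simp add: distrib_left sum_distrib_left)
  also have "\<dots> \<in> Q"
  proof (rule is_idealD(2)[OF Q])
    show "(\<Sum>m\<in>K. ?a ^ N * single m (lookup g m)) - (\<Sum>m\<in>K. single 0 (lookup g m) * G (weight ?S m)) \<in> Q"
      unfolding sum_subtractf[symmetric] by (rule ideal_sum_mem[OF Q normal])
    have "(\<Sum>m\<in>keys g - K. single m (lookup g m)) \<in> Q"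
      by (rule ideal_sum_mem[OF Q outside]) (simp add: K_def)
    then show "?a ^ N * (\<Sum>m\<in>keys g - K. single m (lookup g m)) \<in> Q" by (rule is_idealD(3)[OF Q])
  qed
  finally show ?thesis by blast
qed

text \<open>The ideal and the block prime agree locally at the prime. A deleted vertex
  \<open>z\<close> joins \<open>q\<close> and \<open>r\<close> from different components, whose
  minor is a unit there, so the variables of \<open>z\<close> vanish; \<open>a_p\<close> is a unit
  as well, so \<open>toric_prime_le_saturated\<close> finishes.\<close>

lemma block_prime_le_saturation:
  fixes J :: "('n::finite, 'k::field) bpoly set"
  assumes J: "is_ideal J" and p: "p \<in> W"
    and W: "\<And>v. v \<in> W - {p} \<Longrightarrow> minor p v \<in> J"
    and dead: "\<And>z. z \<notin> U \<union> W \<Longrightarrow> \<exists>q r. q \<noteq> r \<and> q \<in> U \<union> W \<and> r \<in> U \<union> W \<and>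
      \<not> (q \<in> W \<and> r \<in> W) \<and> minor z q \<in> J \<and> minor z r \<in> J"
  shows "block_prime p U W \<subseteq> saturation (block_prime p U W) J"
proof
  let ?P = "block_prime p U W :: ('n, 'k) bpoly set"
  let ?Q = "saturation ?P J"
  note P = is_prime_toric_prime[of "block_map p W" "UNIV \<times> (U \<union> W)"]
  have JQ: "J \<subseteq> ?Q" by (rule saturation_superset[OF P])
  have Q: "is_ideal ?Q" by (rule is_ideal_saturation[OF P J])
  have deadQ: "Var x \<in> ?Q" if x: "x \<notin> UNIV \<times> (U \<union> W)" for x
  proof -
    obtain b z where bz: "x = (b, z)" "z \<notin> U \<union> W" using x by (cases x) auto
    obtain q r where qr: "q \<noteq> r" "q \<in> U \<union> W" "r \<in> U \<union> W" "\<not> (q \<in> W \<and> r \<in> W)"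
      and m: "minor z q \<in> J" "minor z r \<in> J" using dead[OF bz(2)] by blast
    \<comment> \<open>Expansion of the 3 by 3 determinant on columns \<open>q\<close>,
      \<open>r\<close>, \<open>z\<close> in which one of the two rows is repeated.\<close>
    have "minor q r * Var x = Var (b, q) * minor z r - Var (b, r) * (minor z q :: ('n, 'k) bpoly)"
      unfolding minor_def bz(1) by (cases b) (simp_all add: algebra_simps)
    also have "\<dots> \<in> J" by (rule is_idealD(6)[OF J is_idealD(3)[OF J m(2)] is_idealD(3)[OF J m(1)]])
    finally show ?thesis
      unfolding saturation_def using minor_notin_block_prime[OF qr] by blast
  qed
  fix g assume "g \<in> ?P"
  have "minor p v \<in> ?Q" if "v \<in> W - {p}" for v using W[OF that] JQ by blast
  from toric_prime_le_saturated[OF Q this p deadQ \<open>g \<in> ?P\<close>]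
  obtain N where N: "Var (True, p) ^ N * g \<in> ?Q" by blast
  have "(Var (True, p) :: ('n, 'k) bpoly) \<notin> ?P" using p by (simp add: Var_notin_toric_prime)
  then have "(Var (True, p) :: ('n, 'k) bpoly) ^ N \<notin> ?P"
  proof (induction N)
    case 0
    show ?case using prime_one_not_in[OF P] by simp
  next
    case (Suc N)
    then show ?case using prime_not_in_mult[OF P] by simp
  qed
  then have "g \<in> saturation ?P ?Q" using N unfolding saturation_def[of ?P ?Q] by blast
  then show "g \<in> ?Q" unfolding saturation_idem[OF P] .
qed

text \<open>\<open>star\<close> makes the minors at \<open>p\<close> generators, so the block is
  held together by its centre; \<open>cut\<close> says that every deleted vertex joins two different
  components, which makes this prime a component of the ideal. The bound counts the parameters in
  \<open>?T\<close>.\<close>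

lemma local_depth_binomial_edge_ideal_le:
  fixes E :: "'n::finite \<Rightarrow> 'n \<Rightarrow> bool"
  assumes p: "p \<in> W"
    and edges: "\<And>i j. E i j \<Longrightarrow> i \<notin> U \<union> W \<or> j \<notin> U \<union> W \<or> (i \<in> W \<and> j \<in> W)"
    and star: "\<And>v. v \<in> W - {p} \<Longrightarrow> E p v"
    and cut: "\<And>z. z \<notin> U \<union> W \<Longrightarrow> \<exists>q r. q \<noteq> r \<and> q \<in> U \<union> W \<and> r \<in> U \<union> W \<and>
      \<not> (q \<in> W \<and> r \<in> W) \<and> E z q \<and> E z r"
  shows "local_depth (binomial_edge_ideal E :: ('n, 'k::field) bpoly set) origin_ideal
    \<le> enat (2 * card U + card W + 1)"
proof -
  let ?J = "binomial_edge_ideal E :: ('n, 'k) bpoly set"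
  let ?T = "UNIV \<times> U \<union> ({True} \<times> W \<union> {(False, p)})"
  have J: "is_ideal ?J" unfolding binomial_edge_ideal_def by (rule is_ideal_span)
  have "block_prime p U W \<subseteq> saturation (block_prime p U W) ?J"
    by (rule block_prime_le_saturation[OF J p])
      (use star cut in \<open>blast intro: minor_in_binomial_edge_ideal\<close>)+
  then have "local_depth ?J origin_ideal \<le> card ?T"
    using p by (intro local_depth_le[OF J binomial_edge_ideal_le_block_prime[where p = p, OF edges]])
      (auto simp: saturation_def block_map_def split: if_splits)
  also have "card ?T \<le> 2 * card U + card W + 1"
  proof -
    have "card ?T \<le> card (UNIV \<times> U :: (bool \<times> 'n) set) + (card ({True} \<times> W) + card {(False, p)})"
      by (intro order_trans[OF card_Un_le] add_mono order_refl card_Un_le)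
    then show ?thesis by (simp add: card_cartesian_product)
  qed
  finally show ?thesis by simp
qed

lemma not_cohen_macaulay_quotI:
  fixes E :: "'n::finite \<Rightarrow> 'n \<Rightarrow> bool"
  assumes "local_depth (binomial_edge_ideal E :: ('n, 'k::field) bpoly set) origin_ideal \<le> enat r"
    and "enat s \<le> local_dim (binomial_edge_ideal E :: ('n, 'k) bpoly set) origin_ideal" and "r < s"
  shows "\<not> cohen_macaulay_quot (binomial_edge_ideal E :: ('n, 'k) bpoly set)"
proof
  let ?J = "binomial_edge_ideal E :: ('n, 'k) bpoly set"
  assume "cohen_macaulay_quot ?J"
  moreover have "?J \<subseteq> origin_ideal"
    using binomial_edge_ideal_le_block_prime[of E "{}" "{}"]
    by (simp add: origin_ideal_eq[of "block_map _ {}", symmetric])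
  ultimately have "local_depth ?J origin_ideal = local_dim ?J origin_ideal"
    unfolding cohen_macaulay_quot_def using is_maximal_origin_ideal by blast
  then have "enat s \<le> enat r" using assms(1,2) by (metis order_trans)
  then show False using assms(3) by simp
qed

section \<open>Bipartite graphs\<close>

lemma ex_other_than_two:
  assumes "finite A" "card A \<ge> 3" shows "\<exists>z\<in>A. z \<noteq> x \<and> z \<noteq> y"
proof (rule ccontr)
  assume "\<not> ?thesis"
  then have "A \<subseteq> {x, y}" by blast
  then have "card A \<le> card {x, y}" by (intro card_mono) auto
  also have "\<dots> \<le> 2" by (simp add: card_insert_if)
  finally show False using assms by simp
qed

text \<open>Let s = \<open>card A\<close> (points) and k = \<open>card C\<close> (curves). If k is
  at most s, the depth is at most 2k, below s + k + 1. Otherwise the depth is at most 2s +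
  \<open>card L\<close>, where \<open>L\<close> is the set of curves with one point. The dimension
  exceeds this: it is at least s + k + 1 if \<open>L\<close> is empty, at least s + k +
  \<open>card L\<close> if \<open>L\<close> is nonempty and something besides \<open>p\<close> and
  \<open>L\<close> exists, and at least 2k if nothing else exists.\<close>

lemma not_cohen_macaulay_bipartite:
  fixes E :: "'n::finite \<Rightarrow> 'n \<Rightarrow> bool" and A C :: "'n set"
  assumes part: "A \<union> C = UNIV" "A \<inter> C = {}"
    and sym: "\<And>u v. E u v \<Longrightarrow> E v u"
    and bip: "\<And>u v. E u v \<Longrightarrow> u \<in> A \<longleftrightarrow> v \<in> C"
    and C3: "card C \<ge> 3"
    and A2: "\<And>a. a \<in> A \<Longrightarrow> \<exists>c\<in>C. \<exists>c'\<in>C. c \<noteq> c' \<and> E a c \<and> E a c'"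
    and meet: "\<And>c c'. c \<in> C \<Longrightarrow> c' \<in> C \<Longrightarrow> c \<noteq> c' \<Longrightarrow> \<exists>a\<in>A. E a c \<and> E a c'"
  shows "\<not> cohen_macaulay_quot (binomial_edge_ideal E :: ('n, 'k::field) bpoly set)"
proof -
  let ?J = "binomial_edge_ideal E :: ('n, 'k) bpoly set"
  have card_UNIV: "card (UNIV :: 'n set) = card A + card C"
    using card_Un_disjoint[of A C] part by simp
  have bip': "v \<in> A" "u \<in> C" if "E u v" "u \<notin> A" for u v
    using bip[OF that(1)] bip[OF sym[OF that(1)]] that(2) part by blast+
  have inC: "v \<notin> A \<longleftrightarrow> v \<in> C" for v using part by blast
  have dim1: "enat (card A + card C + 1) \<le> local_dim ?J origin_ideal"
    using local_dim_ge[of undefined UNIV "{}" E, where 'k = 'k] by (simp add: card_UNIV)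
  show ?thesis
  proof (cases "card C \<le> card A")
    case True
    obtain c0 where c0: "c0 \<in> C" using C3 by fastforce
    \<comment> \<open>A block of one vertex is as free as an isolated vertex: two parameters for two
      variables. Any curve can serve as \<open>c0\<close>, and the bound is
      \<open>2 * card C\<close>.\<close>
    have "local_depth ?J origin_ideal \<le> enat (2 * card (C - {c0}) + card {c0} + 1)"
    proof (rule local_depth_binomial_edge_ideal_le)
      have C: "(C - {c0}) \<union> {c0} = C" using c0 by blast
      show "i \<notin> C - {c0} \<union> {c0} \<or> j \<notin> C - {c0} \<union> {c0} \<or> (i \<in> {c0} \<and> j \<in> {c0})" if "E i j" for i j
        unfolding C using bip[OF that] inC by blast
      show "\<exists>q r. q \<noteq> r \<and> q \<in> C - {c0} \<union> {c0} \<and> r \<in> C - {c0} \<union> {c0} \<and>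
          \<not> (q \<in> {c0} \<and> r \<in> {c0}) \<and> E z q \<and> E z r" if "z \<notin> C - {c0} \<union> {c0}" for z
      proof -
        have "z \<in> A" using that inC[of z] unfolding C by blast
        then obtain q r where "q \<in> C" "r \<in> C" "q \<noteq> r" "E z q" "E z r" using A2 by blast
        then show ?thesis unfolding C by (intro exI[of _ q] exI[of _ r]) auto
      qed
    qed auto
    then show ?thesis
      by (rule not_cohen_macaulay_quotI[OF _ dim1]) (use c0 True C3 in \<open>simp add: card_Diff_singleton\<close>)
  next
    case False
    \<comment> \<open>A curve with only one point cannot be deleted, since it would not join two
      components; it stays attached to its point.\<close>
    define L where "L = {c \<in> C. \<exists>!a. E a c}"
    have L: "L \<subseteq> C" by (auto simp: L_def)
    obtain c1 c2 where c12: "c1 \<in> C" "c2 \<in> C" "c1 \<noteq> c2"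
    proof -
      obtain c1 where "c1 \<in> C" using C3 by fastforce
      then show ?thesis using ex_other_than_two[OF _ C3, of c1 c1] that by auto
    qed
    \<comment> \<open>The single point of a curve in \<open>L\<close> lies on every curve, because
      any two curves meet. With \<open>L\<close> empty any point will do.\<close>
    have "\<exists>p\<in>A. \<forall>c\<in>L. \<forall>c'\<in>C. E p c \<and> E p c'"
    proof (cases "L = {}")
      case True
      then show ?thesis using meet[OF c12] by blast
    next
      case False
      then obtain c where c: "c \<in> C" "\<exists>!a. E a c" by (auto simp: L_def)
      then obtain p where p: "E p c" "\<And>a. E a c \<Longrightarrow> a = p" by blast
      have "E p c'" if c': "c' \<in> C" for c'
      proof (cases "c = c'")
        case False
        then obtain a where "E a c" "E a c'" using meet[OF c(1) c'] by blast
        then show ?thesis using p(2)[of a] by simp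
      qed (use p(1) in simp)
      moreover have "p \<in> A" using bip[OF p(1)] c(1) by simp
      ultimately show ?thesis using L by blast
    qed
    then obtain p where p: "p \<in> A" "\<And>c c'. c \<in> L \<Longrightarrow> c' \<in> C \<Longrightarrow> E p c \<and> E p c'" by blast
    have leaf: "a = p" if "E a c" "c \<in> L" for a c
      using that p(2)[of c c] L by (auto simp: L_def)
    have pL: "p \<notin> L" using p(1) L part by blast
    have cards: "card (A - {p}) = card A - 1" "card A > 0" "card (insert p L) = Suc (card L)"
      using p(1) pL by (auto simp: card_gt_0_iff)
    \<comment> \<open>Deleting \<open>C - L\<close> leaves the star of \<open>p\<close> with leaves
      \<open>L\<close> as the block and the other points isolated.\<close>
    have "local_depth ?J origin_ideal \<le> enat (2 * card (A - {p}) + card (insert p L) + 1)"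
    proof (rule local_depth_binomial_edge_ideal_le)
      show "p \<in> insert p L" by simp
      have un: "A - {p} \<union> insert p L = A \<union> L" using p(1) by blast
      show "i \<notin> A - {p} \<union> insert p L \<or> j \<notin> A - {p} \<union> insert p L \<or> (i \<in> insert p L \<and> j \<in> insert p L)"
        if "E i j" for i j
        unfolding un using bip[OF that] leaf[OF that] leaf[OF sym[OF that]] inC[of i] inC[of j] L by blast
      show "E p v" if "v \<in> insert p L - {p}" for v using p(2)[of v v] that L by blast
      show "\<exists>q r. q \<noteq> r \<and> q \<in> A - {p} \<union> insert p L \<and> r \<in> A - {p} \<union> insert p L \<and>
          \<not> (q \<in> insert p L \<and> r \<in> insert p L) \<and> E z q \<and> E z r"
        if "z \<notin> A - {p} \<union> insert p L" for z
      proof -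
        have z: "z \<in> C" "z \<notin> L" using that inC[of z] unfolding un by auto
        obtain c where "c \<in> C" "c \<noteq> z" using ex_other_than_two[OF _ C3, of z z] by auto
        then obtain q where q: "q \<in> A" "E q z" using meet[OF z(1)] by blast
        have "\<exists>r. r \<noteq> q \<and> E r z"
        proof (rule ccontr)
          assume "\<not> ?thesis"
          then have "\<exists>!a. E a z" using q(2) by (intro ex1I[of _ q]) auto
          then show False using z unfolding L_def by blast
        qed
        then obtain r where r: "r \<noteq> q" "E r z" by blast
        have "r \<in> A" using bip[OF r(2)] z(1) by simp
        moreover have "\<not> (q \<in> insert p L \<and> r \<in> insert p L)"
          using q(1) \<open>r \<in> A\<close> r(1) L part by blast
        ultimately show ?thesis unfolding un using q r sym[OF q(2)] sym[OF r(2)] by blast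
      qed
    qed
    then have depth: "local_depth ?J origin_ideal \<le> enat (2 * card A + card L)"
      using cards by (cases "card A") auto
    show ?thesis
    proof (cases "L = {}")
      case True
      then show ?thesis using not_cohen_macaulay_quotI[OF depth dim1] False by simp
    next
      case L_ne: False
      \<comment> \<open>Deleting \<open>p\<close> isolates the curves in \<open>L\<close>;
        \<open>W\<close> is all the rest, taken as one block.\<close>
      define W where "W = - insert p L"
      show ?thesis
      proof (cases "W = {}")
        case True
        \<comment> \<open>All curves pass through \<open>p\<close> and have no other point. Depth at
          most k + 2 meets dimension at least 2k, a contradiction because there are at least three
          curves.\<close>
        then have "A \<union> C = insert p L" unfolding W_def part(1) by blast
        then have AC: "A = {p}" "C = L" using p(1) L pL part(2) by blast+
        obtain c0 where c0: "c0 \<in> C" using C3 by fastforce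
        have C: "(C - {c0}) \<union> {c0} = C" using c0 by blast
        have "enat (2 * card (C - {c0}) + card {c0} + 1) \<le> local_dim ?J origin_ideal"
        proof (rule local_dim_ge)
          show "i \<notin> C - {c0} \<union> {c0} \<or> j \<notin> C - {c0} \<union> {c0} \<or> (i \<in> {c0} \<and> j \<in> {c0})" if "E i j" for i j
            unfolding C using bip[OF that] inC by blast
        qed auto
        from not_cohen_macaulay_quotI[OF depth this] show ?thesis
          using c0 C3 AC by (simp add: card_Diff_singleton)
      next
        case False
        then obtain w where w: "w \<in> W" by blast
        have "enat (2 * card L + card W + 1) \<le> local_dim ?J origin_ideal"
        proof (rule local_dim_ge[OF w])
          show "L \<inter> W = {}" by (auto simp: W_def)
          show "i \<notin> L \<union> W \<or> j \<notin> L \<union> W \<or> i \<in> W \<and> j \<in> W" if "E i j" for i j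
            using leaf[OF that] leaf[OF sym[OF that]] pL unfolding W_def by blast
        qed
        moreover have "card W + Suc (card L) = card A + card C"
        proof -
          have "W \<union> insert p L = UNIV" "W \<inter> insert p L = {}" by (auto simp: W_def)
          then show ?thesis using card_UNIV cards(3) card_Un_disjoint[of W "insert p L"] by simp
        qed
        ultimately show ?thesis
          using not_cohen_macaulay_quotI[OF depth] \<open>\<not> card C \<le> card A\<close> by simp
      qed
    qed
  qed
qed

section \<open>Plane curves of equal degree meet\<close>

text \<open>Binary forms as functions: homogeneity together with polynomiality of both
  dehomogenizations is all that finding a zero requires, and it avoids polynomials in two
  variables.\<close>

definition hom_form :: "nat \<Rightarrow> (complex \<Rightarrow> complex \<Rightarrow> complex) \<Rightarrow> bool" where
  "hom_form e \<phi> \<longleftrightarrow> (\<exists>p. \<forall>x. \<phi> x 1 = poly p x) \<and> (\<exists>p. \<forall>y. \<phi> 1 y = poly p y) \<and>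
     (\<forall>t x y. \<phi> (t * x) (t * y) = t ^ e * \<phi> x y)"

lemma hom_form_0: "hom_form e (\<lambda>_ _. 0)"
  unfolding hom_form_def by (auto intro: exI[of _ 0])

lemma hom_form_const: "hom_form 0 (\<lambda>_ _. c)"
  unfolding hom_form_def by (auto intro: exI[of _ "[:c:]"])

lemma hom_form_linear: "hom_form 1 (\<lambda>x y. x * a + y * b)"
  unfolding hom_form_def
proof (intro conjI)
  show "\<exists>p. \<forall>x. x * a + 1 * b = poly p x" by (intro exI[of _ "[:b, a:]"]) simp
  show "\<exists>p. \<forall>y. 1 * a + y * b = poly p y" by (intro exI[of _ "[:a, b:]"]) simp
qed (simp add: algebra_simps)

lemma hom_form_add:
  assumes "hom_form e f" "hom_form e g" shows "hom_form e (\<lambda>x y. f x y + g x y)"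
proof -
  obtain p p' q q' where "\<forall>x. f x 1 = poly p x" "\<forall>y. f 1 y = poly p' y"
    "\<forall>x. g x 1 = poly q x" "\<forall>y. g 1 y = poly q' y"
    using assms unfolding hom_form_def by blast
  then show ?thesis using assms unfolding hom_form_def
    by (auto intro: exI[of _ "p + q"] exI[of _ "p' + q'"] simp: distrib_left)
qed

lemma hom_form_mult:
  assumes "hom_form e f" "hom_form e' g" shows "hom_form (e + e') (\<lambda>x y. f x y * g x y)"
proof -
  obtain p p' q q' where "\<forall>x. f x 1 = poly p x" "\<forall>y. f 1 y = poly p' y"
    "\<forall>x. g x 1 = poly q x" "\<forall>y. g 1 y = poly q' y"
    using assms unfolding hom_form_def by blast
  then show ?thesis using assms unfolding hom_form_def
    by (auto intro: exI[of _ "p * q"] exI[of _ "p' * q'"] simp: power_add)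
qed

lemma hom_form_cmult: "hom_form e f \<Longrightarrow> hom_form e (\<lambda>x y. c * f x y)"
  using hom_form_mult[OF hom_form_const] by fastforce

lemma hom_form_sum:
  "(\<And>i. i \<in> I \<Longrightarrow> hom_form e (f i)) \<Longrightarrow> hom_form e (\<lambda>x y. \<Sum>i\<in>I. f i x y)"
  by (induction I rule: infinite_finite_induct) (auto simp: hom_form_0 intro: hom_form_add)

lemma hom_form_prod:
  "(\<And>i. i \<in> I \<Longrightarrow> hom_form (e i) (f i)) \<Longrightarrow> hom_form (\<Sum>i\<in>I. e i) (\<lambda>x y. \<Prod>i\<in>I. f i x y)"
  by (induction I rule: infinite_finite_induct) (auto simp: hom_form_const intro: hom_form_mult)

text \<open>A root of \<open>p\<close> suffices. Without one, \<open>p\<close> is constant by the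
  fundamental theorem of algebra; homogeneity then makes \<open>q\<close> that constant times
  \<open>y ^ e\<close>, and \<open>e \<ge> 1\<close> gives a zero at \<open>(1, 0)\<close>.\<close>

lemma hom_form_zero:
  assumes "hom_form e \<phi>" "e \<ge> 1"
  shows "\<exists>x y. (x, y) \<noteq> (0, 0) \<and> \<phi> x y = 0"
proof -
  obtain p q where p: "\<And>x. \<phi> x 1 = poly p x" and q: "\<And>y. \<phi> 1 y = poly q y"
    and hom: "\<And>t x y. \<phi> (t * x) (t * y) = t ^ e * \<phi> x y"
    using assms(1) unfolding hom_form_def by blast
  show ?thesis
  proof (cases "\<exists>x. poly p x = 0")
    case True
    then obtain x where "\<phi> x 1 = 0" using p by auto
    then show ?thesis by (intro exI[of _ x] exI[of _ 1]) simp
  next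
    case False
    then have "constant (poly p)" using fundamental_theorem_of_algebra by blast
    then have c: "\<phi> x 1 = poly p 0" for x unfolding p constant_def by blast
    \<comment> \<open>The factor \<open>[:0, 1:]\<close> takes care of \<open>y = 0\<close>, where
      homogeneity does not determine \<open>q\<close>.\<close>
    have "poly ([:0, 1:] * (q - monom (poly p 0) e)) y = 0" for y
    proof (cases "y = 0")
      case False
      have "poly q y = \<phi> (y * (1 / y)) (y * 1)" using False q by simp
      also have "\<dots> = y ^ e * poly p 0" unfolding hom c ..
      finally show ?thesis by (simp add: poly_monom)
    qed simp
    then have "[:0, 1:] * (q - monom (poly p 0) e) = 0" using poly_all_0_iff_0 by blast
    then have "q = monom (poly p 0) e" by (simp add: pCons_eq_0_iff)
    then have "\<phi> 1 0 = 0" using q assms(2) by (simp add: poly_monom)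
    then show ?thesis by (intro exI[of _ 1] exI[of _ 0]) simp
  qed
qed

text \<open>A form of degree \<open>d\<close> in three variables, as a polynomial in the third one.\<close>
definition poly_form :: "nat \<Rightarrow> (complex \<Rightarrow> complex \<Rightarrow> complex poly) \<Rightarrow> bool" where
  "poly_form d f \<longleftrightarrow> (\<forall>x y. degree (f x y) \<le> d) \<and> (\<forall>l\<le>d. hom_form (d - l) (\<lambda>x y. coeff (f x y) l))"

lemma poly_form_coeff_0: "poly_form d f \<Longrightarrow> l > d \<Longrightarrow> coeff (f x y) l = 0"
  unfolding poly_form_def by (metis coeff_eq_0 le_less_trans)

lemma poly_form_1: "poly_form 0 (\<lambda>_ _. 1)"
  unfolding poly_form_def by (auto simp: hom_form_const)

lemma poly_form_linear: "poly_form 1 (\<lambda>x y. [:x * a + y * b, c:])"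
proof -
  have "hom_form (1 - l) (\<lambda>x y. coeff [:x * a + y * b, c:] l)" if "l \<le> 1" for l
    using that hom_form_linear hom_form_const by (cases l) (auto simp: coeff_pCons)
  then show ?thesis unfolding poly_form_def by auto
qed

lemma poly_form_mult:
  assumes f: "poly_form d f" and g: "poly_form e g"
  shows "poly_form (d + e) (\<lambda>x y. f x y * g x y)"
  unfolding poly_form_def
proof (intro conjI allI impI)
  fix x y show "degree (f x y * g x y) \<le> d + e"
    using f g unfolding poly_form_def by (meson add_mono degree_mult_le order_trans)
next
  fix l assume l: "l \<le> d + e"
  show "hom_form (d + e - l) (\<lambda>x y. coeff (f x y * g x y) l)"
    unfolding coeff_mult
  proof (rule hom_form_sum)
    fix i assume i: "i \<in> {..l}"
    show "hom_form (d + e - l) (\<lambda>x y. coeff (f x y) i * coeff (g x y) (l - i))"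
    proof (cases "i \<le> d \<and> l - i \<le> e")
      case True
      then have eq: "d + e - l = (d - i) + (e - (l - i))" using i by auto
      show ?thesis
        unfolding eq by (rule hom_form_mult) (use f g True in \<open>auto simp: poly_form_def\<close>)
    next
      case False
      then have "(\<lambda>x y. coeff (f x y) i * coeff (g x y) (l - i)) = (\<lambda>_ _. 0)"
        using poly_form_coeff_0[OF f] poly_form_coeff_0[OF g] by (auto simp: not_le fun_eq_iff)
      then show ?thesis by (simp only: hom_form_0)
    qed
  qed
qed

lemma poly_form_power: "poly_form d f \<Longrightarrow> poly_form (n * d) (\<lambda>x y. f x y ^ n)"
  by (induction n) (auto simp: poly_form_1 intro: poly_form_mult)

lemma poly_form_smult: "poly_form d f \<Longrightarrow> poly_form d (\<lambda>x y. Polynomial.smult c (f x y))"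
  unfolding poly_form_def by (auto intro: hom_form_cmult order_trans[OF degree_smult_le])

lemma poly_form_sum:
  assumes "\<And>i. i \<in> I \<Longrightarrow> poly_form d (f i)"
  shows "poly_form d (\<lambda>x y. \<Sum>i\<in>I. f i x y)"
  unfolding poly_form_def
proof (intro conjI allI impI)
  fix x y show "degree (\<Sum>i\<in>I. f i x y) \<le> d"
    using assms unfolding poly_form_def by (cases "finite I") (auto intro: degree_sum_le)
next
  fix l assume "l \<le> d"
  then show "hom_form (d - l) (\<lambda>x y. coeff (\<Sum>i\<in>I. f i x y) l)"
    unfolding coeff_sum using assms unfolding poly_form_def by (intro hom_form_sum) auto
qed

text \<open>The coefficient of degree \<open>d\<close> is a form of degree \<open>0\<close>;
  homogeneity with scaling factor \<open>0\<close> and \<open>0 ^ 0 = 1\<close> shows that it is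
  constant.\<close>

lemma poly_form_lead_const: "poly_form d f \<Longrightarrow> coeff (f x y) d = coeff (f 0 0) d"
proof -
  assume "poly_form d f"
  then have "hom_form (d - d) (\<lambda>x y. coeff (f x y) d)" unfolding poly_form_def by blast
  then have "coeff (f (0 * x) (0 * y)) d = 0 ^ (d - d) * coeff (f x y) d"
    unfolding hom_form_def by blast
  then show ?thesis by simp
qed

section \<open>Resultants and common zeros\<close>

lemma dvd_of_dvd_mult_no_common_root:
  fixes f g w :: "complex poly"
  assumes "f \<noteq> 0" "f dvd w * g" "\<And>z. poly f z = 0 \<Longrightarrow> poly g z \<noteq> 0"
  shows "f dvd w"
  using assms
proof (induction "degree f" arbitrary: f w rule: less_induct)
  case less
  show ?case
  proof (cases "degree f = 0")
    case True
    then show ?thesis using less.prems(1) by (simp add: is_unit_iff_degree unit_imp_dvd)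
  next
    case False
    then obtain a where a: "poly f a = 0"
      using fundamental_theorem_of_algebra[of f] constant_degree[of f] by auto
    then obtain f' where f': "f = [:-a, 1:] * f'" by (auto simp: poly_eq_0_iff_dvd elim: dvdE)
    obtain k where "w * g = f * k" using less.prems(2) by (elim dvdE)
    then have "poly (w * g) a = 0" using a by simp
    then have "poly w a = 0" using less.prems(3)[OF a] by simp
    then obtain w' where w': "w = [:-a, 1:] * w'" by (auto simp: poly_eq_0_iff_dvd elim: dvdE)
    have f'0: "f' \<noteq> 0" using less.prems(1) f' by auto
    have nz: "[:-a, 1:] \<noteq> 0" by simp
    have "degree f' < degree f" unfolding f' degree_mult_eq[OF nz f'0] by simp
    moreover have "[:-a, 1:] * f' dvd [:-a, 1:] * (w' * g)"
      using less.prems(2) unfolding f' w' by (simp only: mult.assoc)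
    then have "f' dvd w' * g" using nz by (simp only: dvd_mult_cancel_left) simp
    moreover have "poly g z \<noteq> 0" if "poly f' z = 0" for z
      using less.prems(3)[of z] that unfolding f' by simp
    ultimately have "f' dvd w'" using less.hyps f'0 by blast
    then show ?thesis unfolding f' w' by (intro mult_dvd_mono) auto
  qed
qed

text \<open>The columns are the coefficient vectors of \<open>z^i f\<close> and \<open>z^i g\<close> for \<open>i < d\<close>.\<close>
definition sylvester :: "nat \<Rightarrow> complex poly \<Rightarrow> complex poly \<Rightarrow> complex mat" where
  "sylvester d f g = mat (2 * d) (2 * d) (\<lambda>(j, i).
     if i < d then (if i \<le> j then coeff f (j - i) else 0)
     else (if i - d \<le> j then coeff g (j - (i - d)) else 0))"

text \<open>A kernel vector consists of the coefficients of two polynomials of degree below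
  \<open>d\<close> with \<open>lin 0 * f + lin d * g = 0\<close>. Without a common root
  \<open>f\<close> divides \<open>lin d\<close>, which is too small in degree because
  \<open>f\<close> has degree exactly \<open>d\<close>; so both vanish, and with them the
  vector.\<close>

lemma det_sylvester_0_common_root:
  fixes f g :: "complex poly"
  assumes "det (sylvester d f g) = 0" "degree f = d" "degree g \<le> d" "f \<noteq> 0"
  shows "\<exists>z. poly f z = 0 \<and> poly g z = 0"
proof (rule ccontr)
  assume no: "\<not> ?thesis"
  let ?A = "sylvester d f g"
  have A: "?A \<in> carrier_mat (2 * d) (2 * d)" by (simp add: sylvester_def)
  obtain v where v: "v \<in> carrier_vec (2 * d)" "v \<noteq> 0\<^sub>v (2 * d)" "?A *\<^sub>v v = 0\<^sub>v (2 * d)"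
    using assms(1) det_0_iff_vec_prod_zero_field[OF A] by blast
  define lin where "lin s = (\<Sum>i<d. monom (v $ (s + i)) i)" for s
  have coeff_lin: "coeff (lin s) i = (if i < d then v $ (s + i) else 0)" for s i
    unfolding lin_def coeff_sum coeff_monom by simp
  have conv: "coeff (lin s * h) j = (\<Sum>i<d. (if i \<le> j then coeff h (j - i) else 0) * v $ (s + i))" for s h j
  proof -
    have "coeff (lin s * h) j = (\<Sum>i\<in>{i \<in> {..j}. i < d}. v $ (s + i) * coeff h (j - i))"
      unfolding coeff_mult coeff_lin sum.inter_filter[OF finite_atMost] by (rule sum.cong) auto
    also have "{i \<in> {..j}. i < d} = {i \<in> {..<d}. i \<le> j}" by auto
    also have "(\<Sum>i\<in>{i \<in> {..<d}. i \<le> j}. v $ (s + i) * coeff h (j - i)) =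
      (\<Sum>i<d. (if i \<le> j then coeff h (j - i) else 0) * v $ (s + i))"
      unfolding sum.inter_filter[OF finite_lessThan] by (rule sum.cong) auto
    finally show ?thesis .
  qed
  have deg_lin: "lin s = 0 \<or> degree (lin s) < d" for s
  proof (rule disjCI)
    assume "\<not> degree (lin s) < d"
    then show "lin s = 0" using coeff_lin[of s "degree (lin s)"] by (simp add: leading_coeff_0_iff)
  qed
  have eq: "lin 0 * f + lin d * g = 0"
  proof (rule poly_eqI)
    fix j
    show "coeff (lin 0 * f + lin d * g) j = coeff 0 j"
    proof (cases "j < 2 * d")
      case True
      have "0 = (?A *\<^sub>v v) $ j" using v(3) True by simp
      also have "\<dots> = (\<Sum>i\<in>{0..<2 * d}. ?A $$ (j, i) * v $ i)"
        using True v(1) A by (auto simp: scalar_prod_def intro!: sum.cong)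
      also have "\<dots> = (\<Sum>i\<in>{0..<d}. ?A $$ (j, i) * v $ i) + (\<Sum>i\<in>{d..<d + d}. ?A $$ (j, i) * v $ i)"
        by (subst sum.atLeastLessThan_concat) (auto simp: mult_2)
      also have "(\<Sum>i\<in>{d..<d + d}. ?A $$ (j, i) * v $ i) = (\<Sum>i\<in>{0..<d}. ?A $$ (j, d + i) * v $ (d + i))"
        using sum.shift_bounds_nat_ivl[of "\<lambda>i. ?A $$ (j, i) * v $ i" 0 d d] by (simp add: add.commute)
      also have "(\<Sum>i\<in>{0..<d}. ?A $$ (j, d + i) * v $ (d + i)) = coeff (lin d * g) j"
        unfolding conv atLeast0LessThan using True by (intro sum.cong) (auto simp: sylvester_def)
      also have "(\<Sum>i\<in>{0..<d}. ?A $$ (j, i) * v $ i) = coeff (lin 0 * f) j"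
        unfolding conv atLeast0LessThan using True by (intro sum.cong) (auto simp: sylvester_def)
      finally show ?thesis by simp
    next
      case False
      have "coeff (lin s * h) j = 0" if "degree h \<le> d" for s and h :: "complex poly"
        unfolding conv using False that by (auto intro!: sum.neutral coeff_eq_0)
      then show ?thesis using assms(2,3) by simp
    qed
  qed
  then have "lin d * g = f * (- lin 0)" by (simp add: eq_neg_iff_add_eq_0 algebra_simps)
  then have "f dvd lin d" using dvd_of_dvd_mult_no_common_root[OF assms(4)] no by (metis dvd_triv_left)
  then have "lin d \<noteq> 0 \<Longrightarrow> degree f \<le> degree (lin d)" by (rule dvd_imp_degree_le)
  then have d0: "lin d = 0" using deg_lin[of d] assms(2) by linarith
  then have l0: "lin 0 = 0" using eq assms(4) by simp
  have "v $ i = 0" if "i < 2 * d" for i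
  proof (cases "i < d")
    case True
    then show ?thesis using coeff_lin[of 0 i] l0 by simp
  next
    case False
    then have "i - d < d" "d + (i - d) = i" using that by auto
    then show ?thesis using coeff_lin[of d "i - d"] d0 by simp
  qed
  then have "v = 0\<^sub>v (2 * d)" using v(1) by auto
  then show False using v(2) by blast
qed

text \<open>Inside the band, the entry in row \<open>j\<close> and column \<open>i\<close> is a form
  of degree \<open>d + off i - j\<close>; outside it is zero. Along any permutation the degrees add
  up to \<open>2 * d * d\<close> plus the sum of all \<open>off i\<close> minus the sum of all
  \<open>j\<close>, and \<open>sum_off\<close> turns this into \<open>d * d\<close>.\<close>

lemma hom_form_det_sylvester:
  assumes f: "poly_form d f" and g: "poly_form d g"
  shows "hom_form (d * d) (\<lambda>x y. det (sylvester d (f x y) (g x y)))"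
proof -
  define off where "off i = (if i < d then i else i - d)" for i
  define h where "h i = (if i < d then f else g)" for i :: nat
  have h: "poly_form d (h i)" for i using f g by (simp add: h_def)
  have entry: "sylvester d (f x y) (g x y) $$ (j, i) =
      (if off i \<le> j then coeff (h i x y) (j - off i) else 0)" if "j < 2 * d" "i < 2 * d" for i j x y
    using that by (auto simp: sylvester_def off_def h_def)
  have sum_off: "(\<Sum>i\<in>{0..<2 * d}. i) = (\<Sum>i\<in>{0..<2 * d}. off i) + d * d"
  proof -
    have split: "(\<Sum>i\<in>{0..<2 * d}. k i) = (\<Sum>i\<in>{0..<d}. k i) + (\<Sum>i\<in>{0..<d}. k (i + d))" for k :: "nat \<Rightarrow> nat"
    proof -
      have "(\<Sum>i\<in>{0..<2 * d}. k i) = (\<Sum>i\<in>{0..<d}. k i) + (\<Sum>i\<in>{d..<d + d}. k i)"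
        by (subst sum.atLeastLessThan_concat) (auto simp: mult_2)
      then show ?thesis using sum.shift_bounds_nat_ivl[of k 0 d d] by simp
    qed
    have "(\<Sum>i\<in>{0..<d}. off i) = (\<Sum>i\<in>{0..<d}. i)" by (rule sum.cong) (auto simp: off_def)
    then show ?thesis unfolding split by (simp add: sum.distrib off_def)
  qed
  have summand: "hom_form (d * d) (\<lambda>x y. \<Prod>j\<in>{0..<2 * d}. sylvester d (f x y) (g x y) $$ (j, \<pi> j))"
    if \<pi>: "\<pi> permutes {0..<2 * d}" for \<pi>
  proof (cases "\<forall>j<2 * d. off (\<pi> j) \<le> j \<and> j \<le> d + off (\<pi> j)")
    case True
    have "(\<Sum>j\<in>{0..<2 * d}. d + off (\<pi> j) - j) + (\<Sum>j\<in>{0..<2 * d}. j) = (\<Sum>j\<in>{0..<2 * d}. d + off (\<pi> j))"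
      unfolding sum.distrib[symmetric] by (rule sum.cong) (use True in auto)
    also have "\<dots> = 2 * d * d + (\<Sum>j\<in>{0..<2 * d}. off (\<pi> j))" by (simp add: sum.distrib)
    also have "(\<Sum>j\<in>{0..<2 * d}. off (\<pi> j)) = (\<Sum>j\<in>{0..<2 * d}. off j)"
      using sum.permute[OF \<pi>, of off] by (simp add: comp_def)
    finally have deg: "(\<Sum>j\<in>{0..<2 * d}. d + off (\<pi> j) - j) = d * d" using sum_off by simp
    have "hom_form (\<Sum>j\<in>{0..<2 * d}. d + off (\<pi> j) - j)
      (\<lambda>x y. \<Prod>j\<in>{0..<2 * d}. sylvester d (f x y) (g x y) $$ (j, \<pi> j))"
    proof (rule hom_form_prod)
      fix j assume j: "j \<in> {0..<2 * d}"
      have "\<pi> j < 2 * d" using permutes_in_image[OF \<pi>, of j] j by simp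
      then have "(\<lambda>x y. sylvester d (f x y) (g x y) $$ (j, \<pi> j)) = (\<lambda>x y. coeff (h (\<pi> j) x y) (j - off (\<pi> j)))"
        using j True by (intro ext) (simp add: entry)
      moreover have "hom_form (d - (j - off (\<pi> j))) (\<lambda>x y. coeff (h (\<pi> j) x y) (j - off (\<pi> j)))"
      proof -
        have "j - off (\<pi> j) \<le> d" using True j by auto
        then show ?thesis using h[of "\<pi> j", unfolded poly_form_def] by blast
      qed
      moreover have "d - (j - off (\<pi> j)) = d + off (\<pi> j) - j" using True j by auto
      ultimately show "hom_form (d + off (\<pi> j) - j) (\<lambda>x y. sylvester d (f x y) (g x y) $$ (j, \<pi> j))"
        by simp
    qed
    then show ?thesis unfolding deg .
  next
    case False
    then obtain j where j: "j < 2 * d" "\<not> (off (\<pi> j) \<le> j \<and> j \<le> d + off (\<pi> j))" by blast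
    have "\<pi> j < 2 * d" using permutes_in_image[OF \<pi>, of j] j by simp
    then have "sylvester d (f x y) (g x y) $$ (j, \<pi> j) = 0" for x y
      using j poly_form_coeff_0[OF h] by (auto simp: entry)
    then have "(\<lambda>x y. \<Prod>j\<in>{0..<2 * d}. sylvester d (f x y) (g x y) $$ (j, \<pi> j)) = (\<lambda>_ _. 0)"
      using j(1) by (intro ext prod_zero bexI[of _ j]) auto
    then show ?thesis by (simp only: hom_form_0)
  qed
  have "det (sylvester d (f x y) (g x y)) = (\<Sum>\<pi> | \<pi> permutes {0..<2 * d}.
      signof \<pi> * (\<Prod>j\<in>{0..<2 * d}. sylvester d (f x y) (g x y) $$ (j, \<pi> j)))" for x y
    by (rule det_def') (simp add: sylvester_def)
  then show ?thesis by (simp only:) (intro hom_form_sum hom_form_cmult summand, simp)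
qed

text \<open>The resultant with respect to the third variable is a binary form of positive degree, so
  it vanishes at some nonzero \<open>(x, y)\<close>. The leading coefficient of \<open>f\<close> is
  a nonzero constant, so no degree is lost there and a common root exists.\<close>

lemma poly_form_common_zero:
  assumes f: "poly_form d f" and g: "poly_form d g" and "d \<ge> 1" and lead: "coeff (f 0 0) d \<noteq> 0"
  shows "\<exists>x y z. (x, y) \<noteq> (0, 0) \<and> poly (f x y) z = 0 \<and> poly (g x y) z = 0"
proof -
  have "d * d \<ge> 1" using assms(3) by simp
  from hom_form_zero[OF hom_form_det_sylvester[OF f g] this]
  obtain x y where xy: "(x, y) \<noteq> (0, 0)" "det (sylvester d (f x y) (g x y)) = 0" by blast
  have lead: "coeff (f x y) d \<noteq> 0" using lead poly_form_lead_const[OF f, of x y] by simp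
  then have "f x y \<noteq> 0" by auto
  moreover have "degree (f x y) = d"
    using lead f unfolding poly_form_def by (simp add: le_degree le_antisym)
  moreover have "degree (g x y) \<le> d" using g unfolding poly_form_def by blast
  ultimately show ?thesis using det_sylvester_0_common_root[OF xy(2)] xy(1) by blast
qed

text \<open>Two unit vectors complete \<open>q\<close> to a basis. A nonzero \<open>(x, y)\<close>
  then yields a nonzero point whatever \<open>z\<close> is.\<close>

lemma complement_basis:
  assumes "(q1, q2, q3) \<noteq> (0, 0, 0 :: complex)"
  shows "\<exists>u1 u2 u3 v1 v2 v3 :: complex. \<forall>x y z.
    x * u1 + y * v1 + z * q1 = 0 \<and> x * u2 + y * v2 + z * q2 = 0 \<and> x * u3 + y * v3 + z * q3 = 0
    \<longrightarrow> x = 0 \<and> y = 0"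
proof -
  consider "q1 \<noteq> 0" | "q2 \<noteq> 0" | "q3 \<noteq> 0" using assms by auto
  then show ?thesis
  proof cases
    case 1
    have "\<forall>x y z. x * 0 + y * 0 + z * q1 = 0 \<and> x * 1 + y * 0 + z * q2 = 0 \<and> x * 0 + y * 1 + z * q3 = 0 \<longrightarrow> x = 0 \<and> y = 0"
    proof (intro allI impI)
      fix x y z assume *: "x * 0 + y * 0 + z * q1 = 0 \<and> x * 1 + y * 0 + z * q2 = 0 \<and> x * 0 + y * 1 + z * q3 = 0"
      then have "z = 0" using 1 by simp
      then show "x = 0 \<and> y = 0" using * by simp
    qed
    then show ?thesis by blast
  next
    case 2
    have "\<forall>x y z. x * 1 + y * 0 + z * q1 = 0 \<and> x * 0 + y * 0 + z * q2 = 0 \<and> x * 0 + y * 1 + z * q3 = 0 \<longrightarrow> x = 0 \<and> y = 0"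
    proof (intro allI impI)
      fix x y z assume *: "x * 1 + y * 0 + z * q1 = 0 \<and> x * 0 + y * 0 + z * q2 = 0 \<and> x * 0 + y * 1 + z * q3 = 0"
      then have "z = 0" using 2 by simp
      then show "x = 0 \<and> y = 0" using * by simp
    qed
    then show ?thesis by blast
  next
    case 3
    have "\<forall>x y z. x * 1 + y * 0 + z * q1 = 0 \<and> x * 0 + y * 1 + z * q2 = 0 \<and> x * 0 + y * 0 + z * q3 = 0 \<longrightarrow> x = 0 \<and> y = 0"
    proof (intro allI impI)
      fix x y z assume *: "x * 1 + y * 0 + z * q1 = 0 \<and> x * 0 + y * 1 + z * q2 = 0 \<and> x * 0 + y * 0 + z * q3 = 0"
      then have "z = 0" using 3 by simp
      then show "x = 0 \<and> y = 0" using * by simp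
    qed
    then show ?thesis by blast
  qed
qed

text \<open>Projection from the point \<open>q\<close> off the first curve: in coordinates with
  \<open>q\<close> as third basis vector, the coefficient of the highest power of the third
  coordinate is the value at \<open>q\<close>, hence nonzero.\<close>

lemma common_zero_if_nonvanishing:
  assumes d: "d \<ge> 1" and q: "q \<noteq> (0, 0, 0)" "heval d F q \<noteq> 0"
  shows "\<exists>p. p \<noteq> (0, 0, 0) \<and> heval d F p = 0 \<and> heval d G p = 0"
proof -
  obtain q1 q2 q3 where q': "q = (q1, q2, q3)" by (cases q)
  then obtain u1 u2 u3 v1 v2 v3 where basis: "\<And>x y z.
    x * u1 + y * v1 + z * q1 = 0 \<Longrightarrow> x * u2 + y * v2 + z * q2 = 0 \<Longrightarrow> x * u3 + y * v3 + z * q3 = 0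
    \<Longrightarrow> x = 0 \<and> y = 0" using complement_basis[of q1 q2 q3] q(1) by blast
  let ?p = "\<lambda>x y z. (x * u1 + y * v1 + z * q1, x * u2 + y * v2 + z * q2, x * u3 + y * v3 + z * q3)"
  define line where "line H x y = (\<Sum>m\<in>hmonos d. case m of (a, b, c) \<Rightarrow> Polynomial.smult (H (a, b, c))
    ([:x * u1 + y * v1, q1:] ^ a * [:x * u2 + y * v2, q2:] ^ b * [:x * u3 + y * v3, q3:] ^ c))"
    for H :: hpoly and x y
  have line: "poly_form d (line H)" for H
    unfolding line_def
  proof (rule poly_form_sum)
    fix m assume "m \<in> hmonos d"
    then obtain a b c where m: "m = (a, b, c)" "d = a * 1 + b * 1 + c * 1" by (auto simp: hmonos_def)
    show "poly_form d (\<lambda>x y. case m of (a, b, c) \<Rightarrow> Polynomial.smult (H (a, b, c))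
      ([:x * u1 + y * v1, q1:] ^ a * [:x * u2 + y * v2, q2:] ^ b * [:x * u3 + y * v3, q3:] ^ c))"
      unfolding m prod.case
      by (intro poly_form_smult poly_form_mult poly_form_power poly_form_linear)
  qed
  have eval: "poly (line H x y) z = heval d H (?p x y z)" for H x y z
    unfolding line_def heval_def poly_sum prod.case
    by (rule sum.cong) (auto simp: mult.assoc)
  \<comment> \<open>At \<open>x = y = 0\<close> every lower coefficient is a form of positive degree
    and vanishes, so evaluating at \<open>1\<close> reads off the top coefficient.\<close>
  have "line F 0 0 = monom (coeff (line F 0 0) d) d"
  proof (rule poly_eqI)
    fix l
    have "coeff (line F 0 0) l = 0" if "l < d"
    proof -
      have "hom_form (d - l) (\<lambda>x y. coeff (line F x y) l)"
        using line[of F] that unfolding poly_form_def by simp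
      then have "coeff (line F (0 * 0) (0 * 0)) l = 0 ^ (d - l) * coeff (line F 0 0) l"
        unfolding hom_form_def by blast
      then show ?thesis using that by (simp add: power_0_left)
    qed
    then show "coeff (line F 0 0) l = coeff (monom (coeff (line F 0 0) d) d) l"
      using poly_form_coeff_0[OF line, of l F 0 0] by (cases l d rule: linorder_cases) auto
  qed
  then have "poly (line F 0 0) 1 = coeff (line F 0 0) d" by (metis mult.right_neutral poly_monom power_one)
  then have "coeff (line F 0 0) d \<noteq> 0" using q(2) eval[of F 0 0 1] by (simp add: q')
  from poly_form_common_zero[OF line line d this]
  obtain x y z where "(x, y) \<noteq> (0, 0)" "poly (line F x y) z = 0" "poly (line G x y) z = 0" by blast
  then show ?thesis using basis[of x y z] unfolding eval by (intro exI[of _ "?p x y z"]) auto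
qed

lemma curves_meet:
  assumes "d \<ge> 1"
  shows "\<exists>p. p \<noteq> (0, 0, 0) \<and> heval d F p = 0 \<and> heval d G p = 0"
proof (cases "\<exists>q. q \<noteq> (0, 0, 0) \<and> (heval d F q \<noteq> 0 \<or> heval d G q \<noteq> 0)")
  case True
  then obtain q where q: "q \<noteq> (0, 0, 0)" and "heval d F q \<noteq> 0 \<or> heval d G q \<noteq> 0" by blast
  then consider "heval d F q \<noteq> 0" | "heval d G q \<noteq> 0" by blast
  then show ?thesis
  proof cases
    case 1
    then show ?thesis by (rule common_zero_if_nonvanishing[OF assms q])
  next
    case 2
    from common_zero_if_nonvanishing[OF assms q this, of F] show ?thesis by (simp only: conj_commute)
  qed
next
  case False
  then have "\<forall>q. \<not> (q \<noteq> (0, 0, 0) \<and> (heval d F q \<noteq> 0 \<or> heval d G q \<noteq> 0))"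
    by (simp only: not_ex simp_thms)
  from spec[OF this, of "(1, 0, 0)"] show ?thesis by (intro exI[of _ "(1, 0, 0)"]) simp
qed

section \<open>Levi graphs\<close>

lemma heval_scal: "heval d F (scal t p) = t ^ d * heval d F p"
proof -
  obtain x y z where p: "p = (x, y, z)" by (cases p)
  show ?thesis unfolding p scal_def heval_def prod.case sum_distrib_left
    by (rule sum.cong) (auto simp: hmonos_def power_mult_distrib power_add algebra_simps)
qed

lemma scal_1: "scal 1 p = p"
  by (cases p) (simp add: scal_def)

lemma scal_0_left: "scal 0 p = (0, 0, 0)"
  by (cases p) (simp add: scal_def)

lemma scal_eq_0_iff: "scal t p = (0, 0, 0) \<longleftrightarrow> t = 0 \<or> p = (0, 0, 0)"
  by (cases p) (auto simp: scal_def)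

lemma proj_subset_zero_set_iff:
  assumes "p \<noteq> (0, 0, 0)"
  shows "proj p \<subseteq> zero_set d F \<longleftrightarrow> heval d F p = 0"
proof
  assume "proj p \<subseteq> zero_set d F"
  moreover have "p \<in> proj p" unfolding proj_def using scal_1[of p] by (force intro: exI[of _ 1])
  ultimately show "heval d F p = 0" by (auto simp: zero_set_def)
next
  assume *: "heval d F p = 0"
  show "proj p \<subseteq> zero_set d F"
  proof
    fix q assume "q \<in> proj p"
    then obtain t where t: "q = scal t p" "t \<noteq> 0" unfolding proj_def by blast
    then have "q \<noteq> (0, 0, 0)" using assms by (simp only: scal_eq_0_iff) simp
    then show "q \<in> zero_set d F" using * by (simp add: zero_set_def t(1) heval_scal)
  qed
qed

text \<open>Each product in the Leibniz rule omits one factor only, so a vanishing factor always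
  remains.\<close>

lemma union_singular_if_two:
  assumes "i < k" "j < k" "i \<noteq> j" "p \<noteq> (0, 0, 0)" "heval d (F i) p = 0" "heval d (F j) p = 0"
  shows "union_singular d k F p"
proof -
  have zero: "(\<Prod>l\<in>{..<k} - {m}. heval d (F l) p) = 0" for m
  proof (cases "m = i")
    case True
    then show ?thesis using assms by (intro prod_zero bexI[of _ j]) auto
  next
    case False
    then show ?thesis using assms by (intro prod_zero bexI[of _ i]) auto
  qed
  have "(\<Prod>l<k. heval d (F l) p) = 0" using assms by (intro prod_zero bexI[of _ i]) auto
  then show ?thesis
    using assms(4) unfolding union_singular_def zero scal_0_left by (simp flip: zero_prod_def)
qed

text \<open>If a single curve passes through \<open>p\<close>, the gradient of the product is a
  nonzero multiple of the gradient of that curve, which smoothness keeps away from zero.\<close>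

lemma two_if_union_singular:
  assumes sm: "\<And>j. j < k \<Longrightarrow> smooth_curve d (F j)" and p: "union_singular d k F p"
  shows "\<exists>i<k. \<exists>j<k. i \<noteq> j \<and> heval d (F i) p = 0 \<and> heval d (F j) p = 0"
proof (rule ccontr)
  assume no: "\<not> ?thesis"
  have p0: "p \<noteq> (0, 0, 0)" using p by (simp add: union_singular_def)
  have "(\<Prod>l<k. heval d (F l) p) = 0" using p by (simp add: union_singular_def)
  then obtain i where i: "i < k" "heval d (F i) p = 0" by (auto simp: prod_zero_iff)
  have nz: "heval d (F j) p \<noteq> 0" if "j < k" "j \<noteq> i" for j using no i that by blast
  let ?s = "\<lambda>j. scal (\<Prod>l\<in>{..<k} - {j}. heval d (F l) p) (hgrad d (F j) p)"
  have "?s j = 0" if "j < k" "j \<noteq> i" for j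
  proof -
    have "(\<Prod>l\<in>{..<k} - {j}. heval d (F l) p) = 0"
      using i that by (intro prod_zero bexI[of _ i]) auto
    then show ?thesis by (simp only: scal_0_left zero_prod_def)
  qed
  then have "(\<Sum>j\<in>{..<k} - {i}. ?s j) = 0" by (intro sum.neutral) auto
  moreover have "(\<Sum>j<k. ?s j) = ?s i + (\<Sum>j\<in>{..<k} - {i}. ?s j)"
    using i by (intro sum.remove) auto
  ultimately have "?s i = (0, 0, 0)" using p unfolding union_singular_def by simp
  moreover have "(\<Prod>l\<in>{..<k} - {i}. heval d (F l) p) \<noteq> 0" using nz by simp
  moreover have "hgrad d (F i) p \<noteq> (0, 0, 0)"
    using sm[OF i(1)] p0 i(2) unfolding smooth_curve_def by blast
  ultimately show False unfolding scal_eq_0_iff by blast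
qed

theorem theorem4p8:
  fixes d k :: nat and F :: "nat \<Rightarrow> hpoly"
    and lab :: "cpt set + nat \<Rightarrow> 'n::finite"
  assumes "d_arrangement d k F"
    and "bij_betw lab (levi_vertices d k F) (UNIV :: 'n set)"
  shows "\<not> cohen_macaulay_quot
     (binomial_edge_ideal (\<lambda>i j. levi_edge d k F (inv_into (levi_vertices d k F) lab i)
                                               (inv_into (levi_vertices d k F) lab j))
       :: ('n, 'k::field) bpoly set)"
proof (rule not_cohen_macaulay_bipartite)
  let ?V = "levi_vertices d k F"
  let ?inv = "inv_into ?V lab"
  let ?E = "\<lambda>i j. levi_edge d k F (?inv i) (?inv j)"
  let ?A = "lab ` Inl ` Sing d k F" and ?C = "lab ` Inr ` {..<k}"
  have k: "k \<ge> 3" and d: "d \<ge> 1" and sm: "\<And>j. j < k \<Longrightarrow> smooth_curve d (F j)"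
    using assms(1) unfolding d_arrangement_def by auto
  have inj: "inj_on lab ?V" and surj: "lab ` ?V = UNIV"
    using assms(2) by (auto simp: bij_betw_def)
  have inv: "?inv (lab v) = v" if "v \<in> ?V" for v using inv_into_f_f[OF inj that] .
  have P: "Inl P \<in> ?V" if "P \<in> Sing d k F" for P using that by (auto simp: levi_vertices_def)
  have j: "Inr j \<in> ?V" if "j < k" for j using that by (auto simp: levi_vertices_def)
  show "?A \<union> ?C = UNIV" using surj unfolding levi_vertices_def by (simp add: image_Un)
  show disj: "?A \<inter> ?C = {}"
    using inj_on_image_Int[OF inj, of "Inl ` Sing d k F" "Inr ` {..<k}"] by (auto simp: levi_vertices_def)
  show sym: "?E v u" if "?E u v" for u v
    using that unfolding levi_edge_def by (simp only: insert_commute)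
  show "u \<in> ?A \<longleftrightarrow> v \<in> ?C" if uv: "?E u v" for u v
  proof -
    obtain Q i where Q: "Q \<in> Sing d k F" "i < k" "{?inv u, ?inv v} = {Inl Q, Inr i}"
      using uv unfolding levi_edge_def by blast
    have "u = lab (?inv u)" "v = lab (?inv v)" using f_inv_into_f[of _ lab ?V] surj by auto
    then have "u = lab (Inl Q) \<and> v = lab (Inr i) \<or> u = lab (Inr i) \<and> v = lab (Inl Q)"
      using Q(3) by (auto simp: doubleton_eq_iff)
    then show ?thesis using Q(1,2) disj by blast
  qed
  have "inj_on lab (Inr ` {..<k})" by (rule inj_on_subset[OF inj]) (auto simp: levi_vertices_def)
  then have "card ?C = k" by (simp add: card_image)
  then show "card ?C \<ge> 3" using k by simp
  have adj: "?E (lab (Inl (proj p))) (lab (Inr i))"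
    if "i < k" "union_singular d k F p" "heval d (F i) p = 0" for p i
  proof -
    have "p \<noteq> (0, 0, 0)" using that(2) by (simp add: union_singular_def)
    then have "proj p \<subseteq> zero_set d (F i)" using that(3) by (simp add: proj_subset_zero_set_iff)
    moreover have sing: "proj p \<in> Sing d k F" using that(2) unfolding Sing_def by blast
    ultimately have "levi_edge d k F (Inl (proj p)) (Inr i)"
      unfolding levi_edge_def using that(1) by blast
    then show ?thesis by (simp only: inv[OF P[OF sing]] inv[OF j[OF that(1)]])
  qed
  show "\<exists>c\<in>?C. \<exists>c'\<in>?C. c \<noteq> c' \<and> ?E a c \<and> ?E a c'" if a: "a \<in> ?A" for a
  proof -
    obtain p where p: "a = lab (Inl (proj p))" "union_singular d k F p"
      using a by (auto simp: Sing_def)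
    obtain i i' where i: "i < k" "i' < k" "i \<noteq> i'" "heval d (F i) p = 0" "heval d (F i') p = 0"
      using two_if_union_singular[OF sm p(2)] by blast
    have "lab (Inr i) \<noteq> lab (Inr i')"
      using inj_on_eq_iff[OF inj j[OF i(1)] j[OF i(2)]] i(3) by simp
    then show ?thesis using adj[OF i(1) p(2) i(4)] adj[OF i(2) p(2) i(5)] i(1,2) unfolding p(1) by blast
  qed
  \<comment> \<open>Two curves of the arrangement share a point by \<open>curves_meet\<close>, and a
    point on two of the curves is singular on the union, hence a vertex of the Levi graph.\<close>
  show "\<exists>a\<in>?A. ?E a c \<and> ?E a c'" if c: "c \<in> ?C" "c' \<in> ?C" "c \<noteq> c'" for c c'
  proof -
    obtain i i' where i: "i < k" "i' < k" "c = lab (Inr i)" "c' = lab (Inr i')" using c(1,2) by blast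
    then have "i \<noteq> i'" using c(3) by blast
    obtain p where p: "p \<noteq> (0, 0, 0)" "heval d (F i) p = 0" "heval d (F i') p = 0"
      using curves_meet[OF d] by blast
    have sing: "union_singular d k F p" by (rule union_singular_if_two[OF i(1,2) \<open>i \<noteq> i'\<close> p])
    then have "lab (Inl (proj p)) \<in> ?A" unfolding Sing_def by blast
    then show ?thesis using adj[OF i(1) sing p(2)] adj[OF i(2) sing p(3)] unfolding i(3,4) by blast
  qed
qed

end
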